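(* Let $N\ge 2$, let $D_i\subset\mathbb{R}^n$, $1\le i\le N$, be compact domains, and let $\mu_i$ be finite Borel measures on $D_i$ with $\mu_i(D_i)=\mu_1(D_1)$ for $1\le i\le N$, $\mu_1(\partial D_1)=0$, and $\mu_1(G)>0$ for each nonempty open $G\subset D_1$. Let $c:D_1\times\cdots\times D_N\to\mathbb{R}$ be a Lipschitz $C^1$ cost function such that the map $(x_2,\dots,x_N)\mapsto\nabla_{x_1}c(x_1,x_2,\dots,x_N)$ is injective on $D_2\times\cdots\times D_N$ for each $x_1\in D_1$. If $(f_1,\dots,f_N)\in\mathcal K$ is $c$-conjugate and is a maximizer of the functional $I$ over $\mathcal K$, then the optimal map $(T_2,\dots,T_N)$ for the multi-marginal Monge problem satisfies $$\nabla_{x_1}f_1(x_1)=\nabla_{x_1}c\big(x_1,T_2x_1,\dots,T_Nx_1\big)$$ for $\mu_1$-a.e. $x_1\in D_1$.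
   Context: A compact domain is the closure of a nonempty bounded connected open set. Lipschitz means: there is $K>0$ with $|c(x_1,\dots,x_N)-c(y_1,\dots,y_N)|\le K\,(|x_1-y_1|+\cdots+|x_N-y_N|)$ for all $x_i,y_i\in D_i$. $c$-transform: for $F=(f_1,\dots,f_N)\in C(D_1)\times\cdots\times C(D_N)$ (real-valued continuous functions), the $j$-th $c$-transform of $F$ is $$f_j^c(x_j)=\inf_{z_k\in D_k,\,k\ne j}\Big\{c(z_1,\dots,z_{j-1},x_j,z_{j+1},\dots,z_N)-\sum_{k\ne j}f_k(z_k)\Big\}.$$ The vector $(f_1,\dots,f_N)$ is $c$-conjugate if $f_j=f_j^c$ for all $1\le j\le N$. Admissible class: $\mathcal K=\{(f_1,\dots,f_N)\in C(D_1)\times\cdots\times C(D_N): f_1(x_1)+\cdots+f_N(x_N)\le c(x_1,\dots,x_N)\ \forall x_j\in D_j\}$. Functional: $I(f_1,\dots,f_N)=\sum_{j=1}^N\int_{D_j}f_j\,d\mu_j$. Measure preserving: for a multivalued map $T:D_1\to D_j$, put $T^{-1}(E)=\{x_1\in D_1:T(x_1)\cap E\ne\emptyset\}$; $T$ is measure preserving $(\mu_1,\mu_j)$ if for every Borel set $E\subset D_j$ the set $T^{-1}(E)$ is $\mu_1$-measurable (measurable for the completion of $\mu_1$) and $\mu_1(T^{-1}(E))=\mu_j(E)$. Multi-marginal Monge problem: minimize $\int_{D_1}c(x_1,T_2x_1,\dots,T_Nx_1)\,d\mu_1(x_1)$ among all families of maps $T_j:D_1\to D_j$, $2\le j\le N$,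 possibly multivalued but single-valued for $\mu_1$-a.e. $x_1$, with $T_j$ measure preserving $(\mu_1,\mu_j)$. An optimal map is a minimizer $(T_2,\dots,T_N)$.
   Formalization: Added hypothesis: μ_1 is absolutely continuous with respect to Lebesgue measure, or f_1 is differentiable μ_1-a.e.; without it ∇f_1 may fail to exist on a set of positive μ_1-measure (e.g. c=-xy, μ_1 = Lebesgue plus an atom at a kink of f_1). *)

theory Defs
  imports "HOL-Analysis.Analysis"
begin

text \<open>
  The marginals are indexed by \<open>{1..N}\<close>.  A point of \<open>D\<^sub>1 \<times> \<dots> \<times> D\<^sub>N\<close> is an extensional function in
  \<open>Pi\<^sub>E {1..N} D\<close>, and continuity on this set refers to the product topology of \<open>nat \<Rightarrow> real ^ 'n\<close>.
\<close>

definition compact_domain :: "'a::euclidean_space set \<Rightarrow> bool" where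
  "compact_domain D \<longleftrightarrow> (\<exists>U. open U \<and> connected U \<and> bounded U \<and> U \<noteq> {} \<and> D = closure U)"

definition finite_borel_measure_on :: "'a::euclidean_space set \<Rightarrow> 'a measure \<Rightarrow> bool" where
  "finite_borel_measure_on D \<mu> \<longleftrightarrow>
     finite_measure \<mu> \<and> space \<mu> = D \<and> sets \<mu> = sets (restrict_space borel D)"

definition lipschitz_cost ::
  "nat \<Rightarrow> (nat \<Rightarrow> (real ^ 'n) set) \<Rightarrow> ((nat \<Rightarrow> real ^ 'n) \<Rightarrow> real) \<Rightarrow> bool" where
  "lipschitz_cost N D c \<longleftrightarrow>
     (\<exists>K>0. \<forall>x\<in>Pi\<^sub>E {1..N} D. \<forall>y\<in>Pi\<^sub>E {1..N} D. \<bar>c x - c y\<bar> \<le> K * (\<Sum>i=1..N. norm (x i - y i)))"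

text \<open>
  \<open>c\<close> is \<open>C\<^sup>1\<close> up to the boundary, with partial gradients \<open>grad_c i = \<nabla>\<^bsub>x\<^sub>i\<^esub> c\<close>: these are
  genuine gradients at interior points of the product and extend continuously to all of it.  Since
  each \<open>D i\<close> is the closure of its interior, the values of \<open>grad_c i\<close> on the product, boundary points
  included, are determined by \<open>c\<close>.
\<close>

definition C1_cost ::
  "nat \<Rightarrow> (nat \<Rightarrow> (real ^ 'n) set) \<Rightarrow> ((nat \<Rightarrow> real ^ 'n) \<Rightarrow> real)
     \<Rightarrow> (nat \<Rightarrow> (nat \<Rightarrow> real ^ 'n) \<Rightarrow> real ^ 'n) \<Rightarrow> bool" where
  "C1_cost N D c grad_c \<longleftrightarrow>
     continuous_on (Pi\<^sub>E {1..N} D) c \<and>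
     (\<forall>i\<in>{1..N}. continuous_on (Pi\<^sub>E {1..N} D) (grad_c i)) \<and>
     (\<forall>i\<in>{1..N}. \<forall>x\<in>Pi\<^sub>E {1..N} (\<lambda>k. interior (D k)). GDERIV (\<lambda>y. c (x(i := y))) (x i) :> grad_c i x)"

definition c_transform ::
  "nat \<Rightarrow> (nat \<Rightarrow> (real ^ 'n) set) \<Rightarrow> ((nat \<Rightarrow> real ^ 'n) \<Rightarrow> real)
     \<Rightarrow> (nat \<Rightarrow> real ^ 'n \<Rightarrow> real) \<Rightarrow> nat \<Rightarrow> real ^ 'n \<Rightarrow> real" where
  "c_transform N D c f j x =
     (INF z\<in>Pi\<^sub>E ({1..N} - {j}) D. c (z(j := x)) - (\<Sum>k\<in>{1..N} - {j}. f k (z k)))"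

definition c_conjugate ::
  "nat \<Rightarrow> (nat \<Rightarrow> (real ^ 'n) set) \<Rightarrow> ((nat \<Rightarrow> real ^ 'n) \<Rightarrow> real)
     \<Rightarrow> (nat \<Rightarrow> real ^ 'n \<Rightarrow> real) \<Rightarrow> bool" where
  "c_conjugate N D c f \<longleftrightarrow> (\<forall>j\<in>{1..N}. \<forall>x\<in>D j. f j x = c_transform N D c f j x)"

definition admissible_class ::
  "nat \<Rightarrow> (nat \<Rightarrow> (real ^ 'n) set) \<Rightarrow> ((nat \<Rightarrow> real ^ 'n) \<Rightarrow> real)
     \<Rightarrow> (nat \<Rightarrow> real ^ 'n \<Rightarrow> real) set" where
  "admissible_class N D c =
     {f. (\<forall>j\<in>{1..N}. continuous_on (D j) (f j)) \<and>
         (\<forall>x\<in>Pi\<^sub>E {1..N} D. (\<Sum>j=1..N. f j (x j)) \<le> c x)}"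

definition dual_functional ::
  "nat \<Rightarrow> (nat \<Rightarrow> (real ^ 'n) measure) \<Rightarrow> (nat \<Rightarrow> real ^ 'n \<Rightarrow> real) \<Rightarrow> real" where
  "dual_functional N \<mu> f = (\<Sum>j=1..N. \<integral>x. f j x \<partial>\<mu> j)"

definition dual_maximizer ::
  "nat \<Rightarrow> (nat \<Rightarrow> (real ^ 'n) set) \<Rightarrow> (nat \<Rightarrow> (real ^ 'n) measure)
     \<Rightarrow> ((nat \<Rightarrow> real ^ 'n) \<Rightarrow> real) \<Rightarrow> (nat \<Rightarrow> real ^ 'n \<Rightarrow> real) \<Rightarrow> bool" where
  "dual_maximizer N D \<mu> c f \<longleftrightarrow>
     f \<in> admissible_class N D c \<and>
     (\<forall>g\<in>admissible_class N D c. dual_functional N \<mu> g \<le> dual_functional N \<mu> f)"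

definition mv_preimage :: "'a set \<Rightarrow> ('a \<Rightarrow> 'b set) \<Rightarrow> 'b set \<Rightarrow> 'a set" where
  "mv_preimage A T E = {x\<in>A. T x \<inter> E \<noteq> {}}"

definition measure_preserving_mv ::
  "'a measure \<Rightarrow> 'b::topological_space measure \<Rightarrow> ('a \<Rightarrow> 'b set) \<Rightarrow> bool" where
  "measure_preserving_mv \<mu> \<nu> T \<longleftrightarrow>
     (\<forall>E\<in>sets borel. E \<subseteq> space \<nu> \<longrightarrow>
        mv_preimage (space \<mu>) T E \<in> sets (completion \<mu>) \<and>
        emeasure (completion \<mu>) (mv_preimage (space \<mu>) T E) = emeasure \<nu> E)"

definition monge_competitor ::
  "nat \<Rightarrow> (nat \<Rightarrow> (real ^ 'n) set) \<Rightarrow> (nat \<Rightarrow> (real ^ 'n) measure)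
     \<Rightarrow> (nat \<Rightarrow> real ^ 'n \<Rightarrow> (real ^ 'n) set) \<Rightarrow> bool" where
  "monge_competitor N D \<mu> T \<longleftrightarrow>
     (\<forall>j\<in>{2..N}.
        (\<forall>x\<in>D 1. T j x \<noteq> {} \<and> T j x \<subseteq> D j) \<and>
        (AE x in \<mu> 1. is_singleton (T j x)) \<and>
        measure_preserving_mv (\<mu> 1) (\<mu> j) (T j))"

text \<open>
  The point \<open>(x, T\<^sub>2 x, \<dots>, T\<^sub>N x)\<close>; it is meaningful only where all the sets \<open>T j x\<close> are singletons,
  because \<^const>\<open>the_elem\<close> is unspecified on other sets.
\<close>

definition graph_point ::
  "nat \<Rightarrow> (nat \<Rightarrow> 'a \<Rightarrow> 'a set) \<Rightarrow> 'a \<Rightarrow> nat \<Rightarrow> 'a" where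
  "graph_point N T x = (\<lambda>i\<in>{1..N}. if i = 1 then x else the_elem (T i x))"

text \<open>
  The maps \<open>T j\<close> are only measurable for the completion of \<open>\<mu>\<^sub>1\<close>, hence so is the integrand.
\<close>

definition monge_cost ::
  "nat \<Rightarrow> (nat \<Rightarrow> (real ^ 'n) measure) \<Rightarrow> ((nat \<Rightarrow> real ^ 'n) \<Rightarrow> real)
     \<Rightarrow> (nat \<Rightarrow> real ^ 'n \<Rightarrow> (real ^ 'n) set) \<Rightarrow> real" where
  "monge_cost N \<mu> c T = (\<integral>x. c (graph_point N T x) \<partial>completion (\<mu> 1))"

definition optimal_monge_map ::
  "nat \<Rightarrow> (nat \<Rightarrow> (real ^ 'n) set) \<Rightarrow> (nat \<Rightarrow> (real ^ 'n) measure)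
     \<Rightarrow> ((nat \<Rightarrow> real ^ 'n) \<Rightarrow> real) \<Rightarrow> (nat \<Rightarrow> real ^ 'n \<Rightarrow> (real ^ 'n) set) \<Rightarrow> bool" where
  "optimal_monge_map N D \<mu> c T \<longleftrightarrow>
     monge_competitor N D \<mu> T \<and>
     (\<forall>S. monge_competitor N D \<mu> S \<longrightarrow> monge_cost N \<mu> c T \<le> monge_cost N \<mu> c S)"

text \<open>
  Nothing so far makes \<open>\<nabla>f\<^sub>1\<close> exist \<open>\<mu>\<^sub>1\<close>-almost everywhere: \<open>f\<^sub>1\<close> is Lipschitz, hence
  differentiable Lebesgue-a.e., but \<open>\<mu>\<^sub>1\<close> may charge the exceptional set.  With \<open>N = 2\<close>,
  \<open>c(x, y) = - x y\<close> on \<open>[0, 1]\<^sup>2\<close> and \<open>\<mu>\<^sub>1\<close> = Lebesgue measure plus an atom at \<open>1/2\<close>, let \<open>\<mu>\<^sub>2\<close> be the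
  image of \<open>\<mu>\<^sub>1\<close> under the increasing map \<open>T(x) = x/4\<close> for \<open>x < 1/2\<close>, \<open>T(1/2) = 1/2\<close> and
  \<open>T(x) = 3/4 + x/4\<close> for \<open>x > 1/2\<close>.  Then \<open>T\<close> is optimal and \<open>f\<^sub>1' = - T\<close> off \<open>1/2\<close>, so
  \<open>f\<^sub>1\<close> has no derivative at the atom.  The theorem therefore assumes that \<open>\<mu>\<^sub>1\<close> is absolutely
  continuous or, more generally, that \<open>f\<^sub>1\<close> is differentiable \<open>\<mu>\<^sub>1\<close>-a.e., a condition which
  the conclusion itself entails.
\<close>

end

theory Submission
  imports Defs
begin

text \<open>
  Fix the first coordinate and put \<open>b x z = c (z(1 := x)) - (\<Sum>k=2..N. f k (z k))\<close> for \<open>z\<close> in the compact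
  set \<open>Z = D 2 \<times> \<dots> \<times> D N\<close>.  That \<open>f 1\<close> is the \<open>c\<close>-transform of the other potentials means
  \<open>f 1 x = min\<^sub>z b x z\<close>.  Where the minimizer \<open>z\<close> is unique, the envelope theorem
  (\<open>gderiv_at_unique_minimizer\<close>) gives \<open>\<nabla>f 1 x = \<nabla>\<^sub>x b x z = \<nabla>\<^sub>1 c (z(1 := x))\<close>.  So it remains to see that for
  almost every \<open>x\<close> the minimizer is unique and equals \<open>(T\<^sub>2 x, \<dots>, T\<^sub>N x)\<close>.

  Uniqueness.  If all minimizers at \<open>x\<close> have the same gradient \<open>\<nabla>\<^sub>1 c (z(1 := x))\<close>, injectivity of the
  gradient in \<open>z\<close> leaves only one of them.  At a point of differentiability of \<open>f 1\<close> the gradients agree,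
  since \<open>b y z - f 1 y\<close> is minimal in \<open>y\<close> at \<open>x\<close> for each minimizer \<open>z\<close>.  For absolutely continuous \<open>\<mu> 1\<close>,
  suppose that two minimizers at \<open>x\<close> have different slopes in a direction \<open>e\<close>.  Each one bounds \<open>f 1\<close> from
  above near \<open>x\<close>, and so for a rational number \<open>q\<close> between the slopes the function
  \<open>t \<mapsto> f 1 (x + t e) - q t\<close> has a strict local maximum at \<open>0\<close>.  A real function has only countably many
  strict local maxima, so every line in direction \<open>e\<close> contains countably many such points, and by Fubini
  they form a Lebesgue null set (\<open>null_sets_nonunique_gradient\<close>).

  Optimal maps.  Let \<open>s x\<close> be the unique minimizer.  Replace \<open>f j\<close> by \<open>f j + t h\<close> and \<open>f 1\<close> by the
  corresponding transform; the new potentials are admissible, and as \<open>t\<close> decreases to \<open>0\<close> the difference quotient of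
  the first potential tends to \<open>- h (s x j)\<close>.  As \<open>f\<close> maximizes \<open>I\<close>, this yields
  \<open>\<integral>h d\<mu>\<^sub>j \<le> \<integral>h (s x j) d\<mu>\<^sub>1\<close>, with equality because \<open>- h\<close> is a possible choice too
  (\<open>integral_le_integral_selection\<close>).  Hence \<open>s\<close> pushes \<open>\<mu> 1\<close> to every \<open>\<mu> j\<close>.  Every competitor \<open>T\<close> satisfies
  \<open>cost T - I f = \<integral>(b x (T x) - f 1 x) d\<mu>\<^sub>1 \<ge> 0\<close> (\<open>integral_excess\<close>), and the competitor \<open>s\<close> attains \<open>0\<close>.
  Therefore an optimal \<open>T\<close> attains \<open>0\<close> as well, which forces \<open>T x\<close> to be a minimizer almost everywhere.
\<close>

section \<open>Minimizing a continuous function over a compact parameter set\<close>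

locale compact_minimization =
  fixes X :: "'a::metric_space set" and Z :: "'b::metric_space set" and b :: "'a \<Rightarrow> 'b \<Rightarrow> real"
  assumes compact_X: "compact X" and compact_Z: "compact Z" and Z_nonempty: "Z \<noteq> {}"
    and continuous_b: "continuous_on (X \<times> Z) (\<lambda>(x, z). b x z)"
begin

definition minval :: "'a \<Rightarrow> real" where
  "minval x = (INF z\<in>Z. b x z)"

definition minimizers :: "'a \<Rightarrow> 'b set" where
  "minimizers x = {z \<in> Z. b x z = minval x}"

lemma continuous_objective [continuous_intros]:
  assumes "continuous_on S f" "continuous_on S g" "f ` S \<subseteq> X" "g ` S \<subseteq> Z"
  shows "continuous_on S (\<lambda>p. b (f p) (g p))"
  using continuous_on_compose2[OF continuous_b continuous_on_Pair[OF assms(1,2)]] assms(3,4)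
  by auto

lemma continuous_section: "x \<in> X \<Longrightarrow> continuous_on Z (b x)"
  using continuous_objective[of Z "\<lambda>_. x" "\<lambda>z. z"] by (auto intro!: continuous_intros)

lemma minimizer_exists_le:
  assumes "x \<in> X"
  shows "\<exists>z\<in>minimizers x. \<forall>w\<in>Z. minval x \<le> b x w"
proof -
  obtain z where z: "z \<in> Z" "\<And>w. w \<in> Z \<Longrightarrow> b x z \<le> b x w"
    using continuous_attains_inf[OF compact_Z Z_nonempty continuous_section[OF assms]] by blast
  have "minval x = b x z"
    unfolding minval_def using z by (intro cInf_eq_minimum) auto
  then show ?thesis
    using z by (auto simp: minimizers_def)
qed

lemma minimizers_nonempty: "x \<in> X \<Longrightarrow> minimizers x \<noteq> {}"
  using minimizer_exists_le by blast

lemma minval_le: "x \<in> X \<Longrightarrow> z \<in> Z \<Longrightarrow> minval x \<le> b x z"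
  using minimizer_exists_le by blast

lemma equicontinuous:
  assumes "e > 0"
  obtains d where "d > 0"
    "\<And>x y z. x \<in> X \<Longrightarrow> y \<in> X \<Longrightarrow> z \<in> Z \<Longrightarrow> dist x y < d \<Longrightarrow> \<bar>b x z - b y z\<bar> < e"
proof -
  have "uniformly_continuous_on (X \<times> Z) (\<lambda>(x, z). b x z)"
    using continuous_b compact_X compact_Z by (intro compact_uniformly_continuous compact_Times)
  then obtain d where "d > 0" and d: "\<And>p q. p \<in> X \<times> Z \<Longrightarrow> q \<in> X \<times> Z \<Longrightarrow> dist q p < d \<Longrightarrow>
      dist ((\<lambda>(x, z). b x z) q) ((\<lambda>(x, z). b x z) p) < e"
    using assms unfolding uniformly_continuous_on_def by metis
  show ?thesis
  proof (rule that[OF \<open>d > 0\<close>])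
    fix x y z assume "x \<in> X" "y \<in> X" "z \<in> Z" "dist x y < d"
    then show "\<bar>b x z - b y z\<bar> < e"
      using d[of "(y, z)" "(x, z)"] by (simp add: dist_Pair_Pair dist_real_def)
  qed
qed

lemma minval_diff_less:
  assumes "x \<in> X" "y \<in> X" and "\<And>z. z \<in> Z \<Longrightarrow> \<bar>b x z - b y z\<bar> < e"
  shows "\<bar>minval x - minval y\<bar> < e"
proof -
  obtain z w where "z \<in> Z" "b x z = minval x" "w \<in> Z" "b y w = minval y"
    using minimizers_nonempty assms(1,2) unfolding minimizers_def by blast
  then show ?thesis
    using assms(3)[of z] assms(3)[of w] minval_le[of x w] minval_le[of y z] assms(1,2) by linarith
qed

lemma continuous_minval: "continuous_on X minval"
  unfolding continuous_on_iff
proof (intro ballI allI impI)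
  fix x and e :: real assume "x \<in> X" "e > 0"
  then obtain d where "d > 0"
    "\<And>x y z. x \<in> X \<Longrightarrow> y \<in> X \<Longrightarrow> z \<in> Z \<Longrightarrow> dist x y < d \<Longrightarrow> \<bar>b x z - b y z\<bar> < e"
    using equicontinuous by metis
  then show "\<exists>d>0. \<forall>y\<in>X. dist y x < d \<longrightarrow> dist (minval y) (minval x) < e"
    using minval_diff_less \<open>x \<in> X\<close> by (metis dist_real_def)
qed

lemma minimizer_in_Z: "z \<in> minimizers x \<Longrightarrow> z \<in> Z"
  by (simp add: minimizers_def)

text \<open>
  Away from the unique minimizer \<open>z\<close> the function \<open>b x\<close> exceeds its minimum by a fixed gap, and by
  equicontinuity most of that gap persists at neighbouring points \<open>y\<close>.  Near-minimizers are allowed, with the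
  same \<open>d\<close> as tolerance, so that the lemma serves both for minimizers at nearby points and for minimizers
  of a slightly perturbed objective.
\<close>
lemma near_minimizers_converge:
  assumes x: "x \<in> X" "minimizers x = {z}" and "e > 0"
  obtains d where "d > 0"
    "\<And>y w. y \<in> X \<Longrightarrow> w \<in> Z \<Longrightarrow> dist y x < d \<Longrightarrow> b y w \<le> minval y + d \<Longrightarrow> dist w z < e"
proof (cases "Z - ball z e = {}")
  case True
  then show ?thesis
    using that[of 1] by (force simp: dist_commute)
next
  case False
  have "compact (Z - ball z e)"
    by (intro compact_diff compact_Z) auto
  moreover have "continuous_on (Z - ball z e) (b x)"
    using continuous_section[OF x(1)] by (rule continuous_on_subset) auto
  ultimately obtain v where v: "v \<in> Z - ball z e" "\<And>w. w \<in> Z - ball z e \<Longrightarrow> b x v \<le> b x w"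
    using continuous_attains_inf[OF _ False] by metis
  \<comment> \<open>Three errors share the gap between the least value far from \<open>z\<close> and the minimum: moving \<open>b\<close>
      from \<open>y\<close> to \<open>x\<close>, moving the minimum, and the tolerance for near-minimizers.\<close>
  define \<eta> where "\<eta> = (b x v - minval x) / 3"
  have "v \<noteq> z"
    using v(1) \<open>e > 0\<close> by auto
  then have "v \<notin> minimizers x"
    using x(2) by auto
  then have "\<eta> > 0"
    using v(1) minval_le[OF x(1), of v] unfolding minimizers_def \<eta>_def by force
  obtain d where d: "d > 0"
    "\<And>x y z. x \<in> X \<Longrightarrow> y \<in> X \<Longrightarrow> z \<in> Z \<Longrightarrow> dist x y < d \<Longrightarrow> \<bar>b x z - b y z\<bar> < \<eta>"
    using equicontinuous[OF \<open>\<eta> > 0\<close>] by metis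
  show ?thesis
  proof (rule that[of "min d \<eta>"])
    show "min d \<eta> > 0"
      using d \<open>\<eta> > 0\<close> by simp
    fix y w assume y: "y \<in> X" "dist y x < min d \<eta>" and w: "w \<in> Z" "b y w \<le> minval y + min d \<eta>"
    have "\<bar>minval y - minval x\<bar> < \<eta>"
      using d(2)[OF y(1) x(1)] y by (intro minval_diff_less x y) auto
    moreover have "\<bar>b y w - b x w\<bar> < \<eta>"
      using d(2)[OF y(1) x(1) w(1)] y by auto
    ultimately have "b x w < minval x + 3 * \<eta>"
      using w(2) by linarith
    then have "b x w < b x v"
      by (simp add: \<eta>_def field_simps)
    then show "dist w z < e"
      using v(2)[of w] w(1) by (force simp: dist_commute)
  qed
qed

text \<open>
  The triples \<open>(x, z, w)\<close> of a point and two of its minimizers form a closed subset of a compact set, and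
  projections of compact sets are compact.  Measurability of sets described by minimizers comes from here:
  strict conditions are countable unions of conditions of this form.
\<close>
lemma compact_minimizers_constraint:
  fixes h :: "'a \<Rightarrow> 'b \<Rightarrow> 'b \<Rightarrow> real"
  assumes h: "continuous_on (X \<times> Z \<times> Z) (\<lambda>(x, z, w). h x z w)"
  shows "compact {x \<in> X. \<exists>z\<in>minimizers x. \<exists>w\<in>minimizers x. r \<le> h x z w}"
proof -
  have comp: "compact (X \<times> Z \<times> Z)"
    by (intro compact_Times compact_X compact_Z)
  have c1: "continuous_on (X \<times> Z \<times> Z) (\<lambda>p. b (fst p) (fst (snd p)))"
    by (intro continuous_intros) auto
  have c2: "continuous_on (X \<times> Z \<times> Z) (\<lambda>p. b (fst p) (snd (snd p)))"
    by (intro continuous_intros) auto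
  have c3: "continuous_on (X \<times> Z \<times> Z) (\<lambda>p. minval (fst p))"
    by (rule continuous_on_compose2[OF continuous_minval]) (auto intro!: continuous_intros)
  have c4: "continuous_on (X \<times> Z \<times> Z) (\<lambda>p. h (fst p) (fst (snd p)) (snd (snd p)))"
    using h by (simp add: case_prod_beta')
  have cl: "closed (X \<times> Z \<times> Z)"
    using comp by (rule compact_imp_closed)
  define B1 where "B1 = {p \<in> X \<times> Z \<times> Z. b (fst p) (fst (snd p)) \<le> minval (fst p)}"
  define B2 where "B2 = {p \<in> X \<times> Z \<times> Z. b (fst p) (snd (snd p)) \<le> minval (fst p)}"
  define B3 where "B3 = {p \<in> X \<times> Z \<times> Z. r \<le> h (fst p) (fst (snd p)) (snd (snd p))}"
  have "closed B1" "closed B2" "closed B3"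
    unfolding B1_def B2_def B3_def
    by (intro continuous_on_closed_Collect_le c1 c2 c3 c4 cl continuous_on_const)+
  then have "compact (X \<times> Z \<times> Z \<inter> (B1 \<inter> B2 \<inter> B3))"
    by (intro compact_Int_closed comp closed_Int)
  then have "compact (fst ` (X \<times> Z \<times> Z \<inter> (B1 \<inter> B2 \<inter> B3)))"
    by (intro compact_continuous_image continuous_on_fst continuous_on_id)
  moreover have "fst ` (X \<times> Z \<times> Z \<inter> (B1 \<inter> B2 \<inter> B3)) =
      {x \<in> X. \<exists>z\<in>minimizers x. \<exists>w\<in>minimizers x. r \<le> h x z w}" (is "_ = ?R")
  proof (intro equalityI subsetI)
    fix x assume "x \<in> fst ` (X \<times> Z \<times> Z \<inter> (B1 \<inter> B2 \<inter> B3))"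
    then obtain z w where "x \<in> X" "z \<in> Z" "w \<in> Z" "b x z \<le> minval x" "b x w \<le> minval x" "r \<le> h x z w"
      by (auto simp: B1_def B2_def B3_def)
    then show "x \<in> ?R"
      using minval_le[of x z] minval_le[of x w] by (force simp: minimizers_def)
  next
    fix x assume "x \<in> ?R"
    then obtain z w where "x \<in> X" "z \<in> minimizers x" "w \<in> minimizers x" "r \<le> h x z w"
      by auto
    then have "(x, z, w) \<in> X \<times> Z \<times> Z \<inter> (B1 \<inter> B2 \<inter> B3)"
      by (simp add: B1_def B2_def B3_def minimizers_def)
    then show "x \<in> fst ` (X \<times> Z \<times> Z \<inter> (B1 \<inter> B2 \<inter> B3))"
      by force
  qed
  ultimately show ?thesis
    by simp
qed

lemma borel_nonunique_minimizers:
  "{x \<in> X. \<not> is_singleton (minimizers x)} \<in> sets borel" 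
proof -
  have "{x \<in> X. \<not> is_singleton (minimizers x)} =
    (\<Union>n. {x \<in> X. \<exists>z\<in>minimizers x. \<exists>w\<in>minimizers x. inverse (real (Suc n)) \<le> dist z w})" (is "?L = ?R")
  proof (intro equalityI subsetI)
    fix x assume x: "x \<in> ?L"
    then obtain z where z: "z \<in> minimizers x"
      using minimizers_nonempty by blast
    moreover obtain w where w: "w \<in> minimizers x" "w \<noteq> z"
      using x z by (force simp: is_singleton_def)
    moreover obtain n where "inverse (real (Suc n)) < dist z w"
      using reals_Archimedean[of "dist z w"] w(2) by auto
    then have "inverse (real (Suc n)) \<le> dist z w"
      by simp
    ultimately show "x \<in> ?R"
      using x by blast
  next
    fix x assume "x \<in> ?R"
    then obtain n z w where "x \<in> X" "z \<in> minimizers x" "w \<in> minimizers x" "inverse (real (Suc n)) \<le> dist z w"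
      by auto
    moreover then have "z \<noteq> w"
      by (metis dist_self inverse_positive_iff_positive not_less of_nat_0_less_iff zero_less_Suc)
    ultimately show "x \<in> ?L"
      by (auto simp: is_singleton_def)
  qed
  also have "\<dots> \<in> sets borel"
  proof (intro sets.countable_UN image_subsetI)
    fix n :: nat
    have "continuous_on (X \<times> Z \<times> Z) (\<lambda>(x, z, w). dist z w)"
      by (auto simp: case_prod_beta' intro!: continuous_intros)
    from compact_minimizers_constraint[OF this, of "inverse (real (Suc n))"]
    show "{x \<in> X. \<exists>z\<in>minimizers x. \<exists>w\<in>minimizers x. inverse (real (Suc n)) \<le> dist z w} \<in> sets borel"
      by (intro borel_closed compact_imp_closed)
  qed
  finally show ?thesis .
qed

text \<open>
  Membership in a closed set is the condition \<open>0 \<le> - infdist z C\<close>; the empty set is separate because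
  \<open>infdist z {} = 0\<close>.
\<close>
lemma compact_minimizers_meet:
  assumes "closed C"
  shows "compact {x \<in> X. minimizers x \<inter> C \<noteq> {}}"
proof (cases "C = {}")
  case False
  have "continuous_on (X \<times> Z \<times> Z) (\<lambda>(x, z, w). - infdist z C)"
    by (auto simp: case_prod_beta' intro!: continuous_intros)
  from compact_minimizers_constraint[OF this, of 0]
  moreover have "0 \<le> - infdist z C \<longleftrightarrow> z \<in> C" for z
    using in_closed_iff_infdist_zero[OF assms False, of z] infdist_nonneg[of z C] by linarith
  then have "{x \<in> X. \<exists>z\<in>minimizers x. \<exists>w\<in>minimizers x. 0 \<le> - infdist z C} = {x \<in> X. minimizers x \<inter> C \<noteq> {}}"
    by blast
  ultimately show ?thesis
    by simp
qed simp

text \<open>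
  Where the minimizer is not unique the value is one fixed point of \<open>Z\<close>.  A constant value there, rather than
  an arbitrary minimizer depending on \<open>x\<close>, makes the selection Borel measurable.
\<close>
definition selection :: "'a \<Rightarrow> 'b" where
  "selection x = (if is_singleton (minimizers x) then the_elem (minimizers x) else (SOME z. z \<in> Z))"

lemma minimizers_eq_selection: "is_singleton (minimizers x) \<Longrightarrow> minimizers x = {selection x}"
  by (auto simp: selection_def is_singleton_the_elem)

lemma selection_in_Z: "selection x \<in> Z"
proof (cases "is_singleton (minimizers x)")
  case True
  then show ?thesis
    using minimizers_eq_selection minimizer_in_Z by blast
next
  case False
  then show ?thesis
    using Z_nonempty by (simp add: selection_def some_in_eq)
qed

text \<open>
  Off the Borel set of points with several minimizers, the selection lies in an open set \<open>S\<close> exactly when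
  no minimizer lies in the closed set \<open>- S\<close>.
\<close>
lemma borel_measurable_selection: "selection \<in> borel_measurable (restrict_space borel X)"
proof (rule borel_measurableI)
  fix S :: "'b set" assume "open S"
  define U where "U = {x \<in> X. \<not> is_singleton (minimizers x)}"
  define K where "K = {x \<in> X. minimizers x \<inter> - S \<noteq> {}}"
  have X: "X \<in> sets borel"
    using compact_X by (simp add: borel_closed compact_imp_closed)
  have "U \<in> sets borel"
    unfolding U_def by (rule borel_nonunique_minimizers)
  moreover have "K \<in> sets borel"
    unfolding K_def using \<open>open S\<close>
    by (intro borel_closed compact_imp_closed compact_minimizers_meet closed_Compl)
  ultimately have "(X - K - U) \<union> (if (SOME z. z \<in> Z) \<in> S then U else {}) \<in> sets borel"
    using X by simp
  moreover have "selection -` S \<inter> X = (X - K - U) \<union> (if (SOME z. z \<in> Z) \<in> S then U else {})"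
  proof (intro set_eqI)
    fix x
    show "x \<in> selection -` S \<inter> X \<longleftrightarrow> x \<in> (X - K - U) \<union> (if (SOME z. z \<in> Z) \<in> S then U else {})"
    proof (cases "is_singleton (minimizers x)")
      case True
      then show ?thesis
        using minimizers_eq_selection[OF True] by (auto simp: U_def K_def)
    next
      case False
      then show ?thesis
        by (auto simp: U_def K_def selection_def)
    qed
  qed
  ultimately have "selection -` S \<inter> X \<in> sets borel"
    by simp
  then show "selection -` S \<inter> space (restrict_space borel X) \<in> sets (restrict_space borel X)"
    using X by (simp add: sets_restrict_space_iff space_restrict_space)
qed

text \<open>
  Upper bound: insert a minimizer of \<open>b x\<close> into the perturbed objective.  Lower bound: a minimizer \<open>w\<close> of the
  perturbed objective minimizes \<open>b x\<close> up to \<open>2 t H\<close>, so \<open>near_minimizers_converge\<close> applies to it as \<open>t\<close>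
  tends to \<open>0\<close>.
\<close>
lemma perturbed_minval_bounds:
  fixes h :: "'b \<Rightarrow> real"
  assumes h: "continuous_on Z h" and H: "\<And>z. z \<in> Z \<Longrightarrow> \<bar>h z\<bar> \<le> H" and x: "x \<in> X" and "t > 0"
    and z: "z \<in> minimizers x"
  shows "(INF w\<in>Z. b x w - t * h w) \<le> minval x - t * h z"
    and "\<exists>w\<in>Z. b x w \<le> minval x + 2 * t * H \<and> minval x - t * h w \<le> (INF w\<in>Z. b x w - t * h w)"
proof -
  have "continuous_on Z (\<lambda>w. b x w - t * h w)"
    by (intro continuous_intros h continuous_section x)
  from continuous_attains_inf[OF compact_Z Z_nonempty this]
  obtain w where w: "w \<in> Z" "\<And>v. v \<in> Z \<Longrightarrow> b x w - t * h w \<le> b x v - t * h v"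
    by auto
  have eq: "(INF w\<in>Z. b x w - t * h w) = b x w - t * h w"
    using w by (intro cInf_eq_minimum) auto
  have zZ: "z \<in> Z" and bz: "b x z = minval x"
    using z by (auto simp: minimizers_def)
  show 1: "(INF w\<in>Z. b x w - t * h w) \<le> minval x - t * h z"
    using w(2)[OF zZ] bz eq by simp
  have "h w \<le> H" "- h z \<le> H"
    using H[OF w(1)] H[OF zZ] by linarith+
  then have "t * h w \<le> t * H" "t * (- h z) \<le> t * H"
    using \<open>t > 0\<close> by (intro mult_left_mono; simp)+
  then have "b x w \<le> minval x + 2 * t * H"
    using 1 eq by linarith
  then show "\<exists>w\<in>Z. b x w \<le> minval x + 2 * t * H \<and> minval x - t * h w \<le> (INF w\<in>Z. b x w - t * h w)"
    using w(1) eq minval_le[OF x w(1)] by auto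
qed

lemma perturbed_minval_quotient_bounded:
  fixes h :: "'b \<Rightarrow> real"
  assumes h: "continuous_on Z h" and H: "\<And>z. z \<in> Z \<Longrightarrow> \<bar>h z\<bar> \<le> H" and x: "x \<in> X" and t: "t > 0"
  shows "\<bar>((INF w\<in>Z. b x w - t * h w) - minval x) / t\<bar> \<le> H"
proof -
  obtain z where z: "z \<in> minimizers x"
    using minimizers_nonempty x by blast
  obtain w where w: "w \<in> Z" "minval x - t * h w \<le> (INF w\<in>Z. b x w - t * h w)"
    using perturbed_minval_bounds(2)[OF h H x t z] by blast
  have "((INF w\<in>Z. b x w - t * h w) - minval x) / t \<le> - h z"
    using perturbed_minval_bounds(1)[OF h H x t z] t by (simp add: divide_simps algebra_simps)
  moreover have "- h w \<le> ((INF w\<in>Z. b x w - t * h w) - minval x) / t"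
    using w(2) t by (simp add: divide_simps algebra_simps)
  ultimately show ?thesis
    using H[OF w(1)] H[OF minimizer_in_Z[OF z]] by linarith
qed

text \<open>
  The quotient lies between \<open>- h w\<close> and \<open>- h z\<close>, where \<open>w\<close> minimizes the perturbed objective, and \<open>w\<close> tends to
  \<open>z\<close>.
\<close>
lemma perturbed_minval_derivative:
  fixes h :: "'b \<Rightarrow> real"
  assumes h: "continuous_on Z h" and x: "x \<in> X" "minimizers x = {z}"
    and t: "\<And>n. t n > 0" "t \<longlonglongrightarrow> 0"
  shows "(\<lambda>n. ((INF w\<in>Z. b x w - t n * h w) - minval x) / t n) \<longlonglongrightarrow> - h z"
proof (rule LIMSEQ_I)
  fix r :: real assume "r > 0"
  have "z \<in> Z"
    using x by (auto intro: minimizer_in_Z)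
  obtain e where e: "e > 0" "\<And>w. w \<in> Z \<Longrightarrow> dist w z < e \<Longrightarrow> dist (h w) (h z) < r"
    using h \<open>r > 0\<close> \<open>z \<in> Z\<close> unfolding continuous_on_iff by metis
  obtain d where d: "d > 0"
    "\<And>y w. y \<in> X \<Longrightarrow> w \<in> Z \<Longrightarrow> dist y x < d \<Longrightarrow> b y w \<le> minval y + d \<Longrightarrow> dist w z < e"
    using near_minimizers_converge[OF x \<open>e > 0\<close>] by metis
  have "bounded (h ` Z)"
    using h compact_Z compact_continuous_image compact_imp_bounded by blast
  then obtain H where H: "\<And>z. z \<in> Z \<Longrightarrow> \<bar>h z\<bar> \<le> H"
    unfolding bounded_iff by auto
  have "(\<lambda>n. 2 * t n * H) \<longlonglongrightarrow> 2 * 0 * H"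
    by (intro tendsto_intros t)
  then obtain N where N: "\<And>n. n \<ge> N \<Longrightarrow> 2 * t n * H < d"
    using order_tendstoD(2)[of "\<lambda>n. 2 * t n * H" 0 sequentially d] d(1)
    by (auto simp: eventually_sequentially)
  have "norm (((INF w\<in>Z. b x w - t n * h w) - minval x) / t n - - h z) < r" if "n \<ge> N" for n
  proof -
    have z: "z \<in> minimizers x"
      using x by simp
    obtain w where w: "w \<in> Z" "b x w \<le> minval x + 2 * t n * H"
        "minval x - t n * h w \<le> (INF w\<in>Z. b x w - t n * h w)"
      using perturbed_minval_bounds(2)[OF h H x(1) t(1) z] by metis
    have "dist w z < e"
      using d(2)[OF x(1) w(1)] d(1) w(2) N[OF that] by simp
    then have "\<bar>h w - h z\<bar> < r"
      using e(2) w(1) by (simp add: dist_real_def)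
    moreover have "((INF w\<in>Z. b x w - t n * h w) - minval x) / t n \<le> - h z"
      using perturbed_minval_bounds(1)[OF h H x(1) t(1) z] t(1)[of n] by (simp add: divide_simps algebra_simps)
    moreover have "- h w \<le> ((INF w\<in>Z. b x w - t n * h w) - minval x) / t n"
      using w(3) t(1)[of n] by (simp add: divide_simps algebra_simps)
    ultimately show ?thesis
      by (simp add: abs_if split: if_splits)
  qed
  then show "\<exists>N. \<forall>n\<ge>N. norm (((INF w\<in>Z. b x w - t n * h w) - minval x) / t n - - h z) < r"
    by blast
qed

end

section \<open>Differentiability of the value function at a unique minimizer\<close>

text \<open>
  Only the points of \<open>X\<close> have to be tested.  So a potential may take arbitrary values outside its domain.
\<close>
lemma gderiv_interiorI:
  fixes F :: "'a::euclidean_space \<Rightarrow> real"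
  assumes x: "x \<in> interior X"
    and F: "\<And>e. e > 0 \<Longrightarrow> \<exists>d>0. \<forall>y\<in>X. dist y x < d \<longrightarrow> \<bar>F y - F x - (y - x) \<bullet> g\<bar> \<le> e * norm (y - x)"
  shows "GDERIV F x :> g"
  unfolding gderiv_def has_derivative_at_alt
proof (intro conjI allI impI)
  show "bounded_linear (\<lambda>h. h \<bullet> g)"
    by (rule bounded_linear_inner_left)
  fix e :: real assume "e > 0"
  then obtain d where d: "d > 0" "\<And>y. y \<in> X \<Longrightarrow> dist y x < d \<Longrightarrow> \<bar>F y - F x - (y - x) \<bullet> g\<bar> \<le> e * norm (y - x)"
    using F by blast
  obtain r where r: "r > 0" "ball x r \<subseteq> X"
    using x mem_interior by blast
  show "\<exists>d>0. \<forall>y. norm (y - x) < d \<longrightarrow> norm (F y - F x - (y - x) \<bullet> g) \<le> e * norm (y - x)"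
  proof (intro exI[of _ "min d r"] conjI allI impI)
    fix y assume y: "norm (y - x) < min d r"
    then have "y \<in> X"
      using r(2) by (auto simp: dist_norm norm_minus_commute)
    then show "norm (F y - F x - (y - x) \<bullet> g) \<le> e * norm (y - x)"
      using d(2)[of y] y by (simp add: dist_norm)
  qed (use d(1) r(1) in simp)
qed

text \<open>
  The derivative is uniform in the parameter.  This is what the envelope theorem uses, because the minimizer at
  \<open>y\<close> varies with \<open>y\<close> while the expansion is taken at \<open>x\<close>.
\<close>
locale differentiable_minimization = compact_minimization X Z b
  for X :: "'a::euclidean_space set" and Z :: "'b::metric_space set" and b :: "'a \<Rightarrow> 'b \<Rightarrow> real" +
  fixes G :: "'a \<Rightarrow> 'b \<Rightarrow> 'a"
  assumes continuous_G: "continuous_on (X \<times> Z) (\<lambda>(x, z). G x z)"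
    and uniform_gderiv: "\<And>x e. x \<in> interior X \<Longrightarrow> e > 0 \<Longrightarrow>
      \<exists>d>0. \<forall>y\<in>X. \<forall>z\<in>Z. dist y x < d \<longrightarrow> \<bar>b y z - b x z - (y - x) \<bullet> G x z\<bar> \<le> e * norm (y - x)"
begin

lemma continuous_gradient [continuous_intros]:
  assumes "continuous_on S f" "continuous_on S g" "f ` S \<subseteq> X" "g ` S \<subseteq> Z"
  shows "continuous_on S (\<lambda>p. G (f p) (g p))"
  using continuous_on_compose2[OF continuous_G continuous_on_Pair[OF assms(1,2)]] assms(3,4)
  by auto

lemma gderiv_section:
  assumes "x \<in> interior X" "z \<in> Z"
  shows "GDERIV (\<lambda>y. b y z) x :> G x z"
  using assms(1)
proof (rule gderiv_interiorI)
  fix e :: real assume "e > 0"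
  from uniform_gderiv[OF assms(1) this]
  show "\<exists>d>0. \<forall>y\<in>X. dist y x < d \<longrightarrow> \<bar>b y z - b x z - (y - x) \<bullet> G x z\<bar> \<le> e * norm (y - x)"
    using assms(2) by blast
qed

text \<open>
  The envelope theorem.  The minimizer \<open>z\<close> at \<open>x\<close> bounds \<open>minval y\<close> from above by its first-order expansion.
  From below, a minimizer \<open>w\<close> at \<open>y\<close> gives an expansion with slope \<open>G x w\<close>, and this slope is close to \<open>G x z\<close>
  because \<open>w\<close> tends to \<open>z\<close>.
\<close>
lemma gderiv_at_unique_minimizer:
  assumes x: "x \<in> interior X" "minimizers x = {z}" and F: "\<And>y. y \<in> X \<Longrightarrow> F y = minval y"
  shows "GDERIV F x :> G x z"
  using x(1)
proof (rule gderiv_interiorI)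
  fix e :: real assume "e > 0"
  have xX: "x \<in> X"
    using x(1) interior_subset by blast
  have z: "z \<in> Z" "b x z = minval x"
    using x(2) by (auto simp: minimizers_def)
  have "continuous_on Z (G x)"
    using xX by (intro continuous_intros) auto
  then obtain r where r: "r > 0" "\<And>w. w \<in> Z \<Longrightarrow> dist w z < r \<Longrightarrow> dist (G x w) (G x z) < e / 2"
    using \<open>e > 0\<close> z(1) unfolding continuous_on_iff by (metis half_gt_zero)
  obtain d1 where d1: "d1 > 0"
    "\<And>y w. y \<in> X \<Longrightarrow> w \<in> Z \<Longrightarrow> dist y x < d1 \<Longrightarrow> b y w \<le> minval y + d1 \<Longrightarrow> dist w z < r"
    using near_minimizers_converge[OF xX x(2) r(1)] by metis
  obtain d2 where d2: "d2 > 0"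
    "\<And>y w. y \<in> X \<Longrightarrow> w \<in> Z \<Longrightarrow> dist y x < d2 \<Longrightarrow>
      \<bar>b y w - b x w - (y - x) \<bullet> G x w\<bar> \<le> e / 2 * norm (y - x)"
    using uniform_gderiv[OF x(1), of "e / 2"] \<open>e > 0\<close> by auto
  have "\<bar>F y - F x - (y - x) \<bullet> G x z\<bar> \<le> e * norm (y - x)" if y: "y \<in> X" "dist y x < min d1 d2" for y
  proof -
    obtain w where w: "w \<in> Z" "b y w = minval y"
      using minimizers_nonempty[OF y(1)] by (auto simp: minimizers_def)
    have "dist w z < r"
      using d1 w y by simp
    then have "norm (G x w - G x z) \<le> e / 2"
      using r(2)[OF w(1)] by (simp add: dist_norm)
    then have "norm (y - x) * norm (G x w - G x z) \<le> norm (y - x) * (e / 2)"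
      by (rule mult_left_mono) simp
    then have "\<bar>(y - x) \<bullet> (G x w - G x z)\<bar> \<le> e / 2 * norm (y - x)"
      using Cauchy_Schwarz_ineq2[of "y - x" "G x w - G x z"] by (simp add: mult.commute)
    then have "(y - x) \<bullet> G x z - e / 2 * norm (y - x) \<le> (y - x) \<bullet> G x w"
      unfolding inner_diff_right by linarith
    moreover have "\<bar>b y w - b x w - (y - x) \<bullet> G x w\<bar> \<le> e / 2 * norm (y - x)"
      "\<bar>b y z - b x z - (y - x) \<bullet> G x z\<bar> \<le> e / 2 * norm (y - x)"
      using d2(2) y w(1) z(1) by auto
    moreover have "minval x \<le> b x w" "minval y \<le> b y z" "F x = minval x" "F y = minval y"
      using minval_le xX y(1) w(1) z(1) F by auto
    moreover have "e * norm (y - x) = e / 2 * norm (y - x) + e / 2 * norm (y - x)" "0 \<le> e / 2 * norm (y - x)"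
      using \<open>e > 0\<close> by simp_all
    ultimately show ?thesis
      using w(2) z(2) by linarith
  qed
  then show "\<exists>d>0. \<forall>y\<in>X. dist y x < d \<longrightarrow> \<bar>F y - F x - (y - x) \<bullet> G x z\<bar> \<le> e * norm (y - x)"
    using d1(1) d2(1) by (intro exI[of _ "min d1 d2"]) auto
qed

text \<open>
  For a minimizer \<open>v\<close> at \<open>x\<close>, the function \<open>y \<mapsto> b y v - F y\<close> is nonnegative and vanishes at \<open>x\<close>, so
  its derivative \<open>h \<mapsto> h \<bullet> G x v - F' h\<close> vanishes and \<open>G x v\<close> is determined by \<open>F\<close>.
\<close>
lemma gradient_unique_if_differentiable:
  assumes x: "x \<in> interior X" and F: "\<And>y. y \<in> X \<Longrightarrow> F y = minval y" and "F differentiable (at x)"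
    and z: "z \<in> minimizers x" "w \<in> minimizers x"
  shows "G x z = G x w"
proof -
  obtain F' where F': "(F has_derivative F') (at x)"
    using assms(3) by (auto simp: differentiable_def)
  have "h \<bullet> G x v = F' h" if v: "v \<in> minimizers x" for v h
  proof -
    have vZ: "v \<in> Z" "b x v = minval x"
      using v by (auto simp: minimizers_def)
    have "((\<lambda>y. b y v - F y) has_derivative (\<lambda>h. h \<bullet> G x v - F' h)) (at x)"
      using gderiv_section[OF x vZ(1)] F' unfolding gderiv_def by (rule has_derivative_diff)
    moreover have "\<forall>y\<in>interior X. b x v - F x \<le> b y v - F y"
      using F vZ(2) x interior_subset[of X] minval_le[OF _ vZ(1)]
      by (simp add: subset_iff)
    ultimately have "(\<lambda>h. h \<bullet> G x v - F' h) = (\<lambda>_. 0)"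
      using differential_zero_maxmin[OF x open_interior, of "\<lambda>y. b y v - F y"] by blast
    then show ?thesis
      by (metis eq_iff_diff_eq_0)
  qed
  then have "h \<bullet> G x z = h \<bullet> G x w" for h
    using z by simp
  then show ?thesis
    by (metis vector_eq_ldot)
qed

end

section \<open>The minimizers have a common gradient almost everywhere\<close>

text \<open>
  A strict local maximum is the only maximum on some interval with rational endpoints, and there are countably
  many such intervals.
\<close>
lemma countable_strict_local_maxima:
  fixes \<phi> :: "real \<Rightarrow> real"
  shows "countable {t. \<exists>d>0. \<forall>u. u \<noteq> t \<and> \<bar>u - t\<bar> < d \<longrightarrow> \<phi> u < \<phi> t}"
proof -
  define P where "P = (\<lambda>r s. {t. r < t \<and> t < s \<and> (\<forall>u. r < u \<and> u < s \<and> u \<noteq> t \<longrightarrow> \<phi> u < \<phi> t)})"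
  have "t = t'" if "t \<in> P r s" "t' \<in> P r s" for r s t t'
    using that unfolding P_def by (metis (mono_tags, lifting) less_asym mem_Collect_eq)
  then have "P r s \<subseteq> {SOME t. t \<in> P r s}" for r s
    by (metis singletonI someI subsetI)
  then have "countable (P r s)" for r s
    by (rule countable_subset) simp
  then have "countable (\<Union>r\<in>\<rat>. \<Union>s\<in>\<rat>. P r s)"
    by (intro countable_UN countable_rat)
  moreover have "{t. \<exists>d>0. \<forall>u. u \<noteq> t \<and> \<bar>u - t\<bar> < d \<longrightarrow> \<phi> u < \<phi> t} \<subseteq> (\<Union>r\<in>\<rat>. \<Union>s\<in>\<rat>. P r s)"
  proof
    fix t assume "t \<in> {t. \<exists>d>0. \<forall>u. u \<noteq> t \<and> \<bar>u - t\<bar> < d \<longrightarrow> \<phi> u < \<phi> t}"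
    then obtain d where d: "d > 0" "\<And>u. u \<noteq> t \<Longrightarrow> \<bar>u - t\<bar> < d \<Longrightarrow> \<phi> u < \<phi> t"
      by blast
    obtain r where r: "r \<in> \<rat>" "t - d < r" "r < t"
      using Rats_dense_in_real[of "t - d" t] d(1) by auto
    obtain s where s: "s \<in> \<rat>" "t < s" "s < t + d"
      using Rats_dense_in_real[of t "t + d"] d(1) by auto
    have "t \<in> P r s"
      using r s by (auto simp: P_def intro!: d(2))
    then show "t \<in> (\<Union>r\<in>\<rat>. \<Union>s\<in>\<rat>. P r s)"
      using r(1) s(1) by blast
  qed
  ultimately show ?thesis
    by (rule countable_subset[rotated])
qed

text \<open>
  By translation invariance, \<open>emeasure lborel B\<close> is \<open>\<integral>indicator B (x + t *\<^sub>R e) dx\<close> for every \<open>t\<close>.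
  Integrating over \<open>t\<close> and exchanging the integrals leaves integrals over countable sets, which are \<open>0\<close>; and
  the constant \<open>emeasure lborel B\<close> has a finite integral over the real line only if it is \<open>0\<close>.
\<close>
lemma null_sets_lborel_countable_lines:
  fixes B :: "'a::euclidean_space set" and e :: 'a
  assumes B: "B \<in> sets borel" and lines: "\<And>x. countable {t::real. x + t *\<^sub>R e \<in> B}"
  shows "B \<in> null_sets lborel"
proof -
  have meas: "(\<lambda>(x, t). indicator B (x + t *\<^sub>R e) :: ennreal)
      \<in> borel_measurable (lborel \<Otimes>\<^sub>M lborel)"
    using B by measurable
  have slice: "(\<integral>\<^sup>+x. indicator B (x + t *\<^sub>R e) \<partial>lborel) = emeasure lborel B" for t :: real
  proof -
    have "emeasure lborel B = (\<integral>\<^sup>+x. indicator B x \<partial>distr lborel borel ((+) (t *\<^sub>R e)))"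
      using B by (simp add: lborel_distr_plus)
    also have "\<dots> = (\<integral>\<^sup>+x. indicator B (t *\<^sub>R e + x) \<partial>lborel)"
      using B by (intro nn_integral_distr) auto
    finally show ?thesis
      by (simp add: add.commute)
  qed
  have line0: "(\<integral>\<^sup>+t. indicator B (x + t *\<^sub>R e) \<partial>(lborel :: real measure)) = 0" for x
  proof -
    have "{t. x + t *\<^sub>R e \<in> B} \<in> null_sets lborel"
      by (intro countable_imp_null_set_lborel lines)
    from AE_not_in[OF this] have "AE t in (lborel :: real measure). indicator B (x + t *\<^sub>R e) = (0 :: ennreal)"
      by eventually_elim simp
    then show ?thesis
      by (subst nn_integral_cong_AE[of _ "\<lambda>_. 0"]) auto
  qed
  have "(\<integral>\<^sup>+t. emeasure lborel B \<partial>(lborel :: real measure)) =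
      (\<integral>\<^sup>+t. \<integral>\<^sup>+x. indicator B (x + t *\<^sub>R e) \<partial>lborel \<partial>(lborel :: real measure))"
    by (simp add: slice)
  also have "\<dots> = (\<integral>\<^sup>+x. \<integral>\<^sup>+t. indicator B (x + t *\<^sub>R e) \<partial>(lborel :: real measure) \<partial>lborel)"
    by (rule lborel_pair.Fubini'[OF meas])
  also have "\<dots> = 0"
    by (simp add: line0)
  finally have "emeasure lborel B = 0"
    by (simp add: ennreal_mult_eq_top_iff)
  then show ?thesis
    using B by auto
qed

context differentiable_minimization
begin

text \<open>
  Near a point \<open>x\<close> of the set, the minimizer of smaller slope bounds \<open>minval\<close> from above in direction \<open>e\<close>, and
  that of larger slope in direction \<open>- e\<close>.  With a rational \<open>q\<close> strictly between the slopes, subtracting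
  \<open>q t\<close> turns \<open>x\<close> into a strict local maximum along the line.
\<close>
lemma null_sets_nonunique_slope:
  assumes e: "norm e = 1"
  shows "{x \<in> interior X. \<exists>z\<in>minimizers x. \<exists>w\<in>minimizers x. e \<bullet> G x z < e \<bullet> G x w} \<in> null_sets lborel"
    (is "?B \<in> _")
proof (rule null_sets_lborel_countable_lines[where e = e])
  have "?B = interior X \<inter> (\<Union>n. {x \<in> X. \<exists>z\<in>minimizers x. \<exists>w\<in>minimizers x.
      inverse (real (Suc n)) \<le> e \<bullet> G x w - e \<bullet> G x z})" (is "_ = ?R")
  proof (intro equalityI subsetI)
    fix x assume x: "x \<in> ?B"
    then obtain z w where zw: "z \<in> minimizers x" "w \<in> minimizers x" "e \<bullet> G x z < e \<bullet> G x w"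
      by blast
    then obtain n where "inverse (real (Suc n)) < e \<bullet> G x w - e \<bullet> G x z"
      using reals_Archimedean[of "e \<bullet> G x w - e \<bullet> G x z"] by auto
    then have "inverse (real (Suc n)) \<le> e \<bullet> G x w - e \<bullet> G x z"
      by simp
    then show "x \<in> ?R"
      using x zw(1,2) interior_subset by blast
  next
    fix x assume x: "x \<in> ?R"
    then obtain n z w where zw: "z \<in> minimizers x" "w \<in> minimizers x"
        "inverse (real (Suc n)) \<le> e \<bullet> G x w - e \<bullet> G x z"
      by blast
    have "0 < inverse (real (Suc n))"
      by simp
    then have "e \<bullet> G x z < e \<bullet> G x w"
      using zw(3) by linarith
    then show "x \<in> ?B"
      using x zw(1,2) by blast
  qed
  also have "\<dots> \<in> sets borel"
  proof (rule sets.Int[OF borel_open[OF open_interior] sets.countable_UN], rule image_subsetI)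
    fix n :: nat
    have "continuous_on (X \<times> Z \<times> Z) (\<lambda>p. e \<bullet> G (fst p) (snd (snd p)) - e \<bullet> G (fst p) (fst (snd p)))"
      by (intro continuous_intros) auto
    then have "continuous_on (X \<times> Z \<times> Z) (\<lambda>(x, z, w). e \<bullet> G x w - e \<bullet> G x z)"
      by (simp add: case_prod_beta')
    from compact_minimizers_constraint[OF this, of "inverse (real (Suc n))"]
    show "{x \<in> X. \<exists>z\<in>minimizers x. \<exists>w\<in>minimizers x.
        inverse (real (Suc n)) \<le> e \<bullet> G x w - e \<bullet> G x z} \<in> sets borel"
      by (intro borel_closed compact_imp_closed)
  qed
  finally show "?B \<in> sets borel" .
next
  fix x0 :: 'a
  define \<phi> where "\<phi> = (\<lambda>q t. minval (x0 + t *\<^sub>R e) - q * t)"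
  have "{t. x0 + t *\<^sub>R e \<in> ?B} \<subseteq>
      (\<Union>q\<in>\<rat>. {t. \<exists>d>0. \<forall>u. u \<noteq> t \<and> \<bar>u - t\<bar> < d \<longrightarrow> \<phi> q u < \<phi> q t})"
  proof
    fix t assume "t \<in> {t. x0 + t *\<^sub>R e \<in> ?B}"
    define x where "x = x0 + t *\<^sub>R e"
    then have x: "x \<in> interior X"
      using \<open>t \<in> _\<close> by blast
    obtain z w where zw: "z \<in> minimizers x" "w \<in> minimizers x" and less: "e \<bullet> G x z < e \<bullet> G x w"
      using \<open>t \<in> _\<close> unfolding x_def by blast
    obtain q where q: "q \<in> \<rat>" "e \<bullet> G x z < q" "q < e \<bullet> G x w"
      using Rats_dense_in_real[OF less] by blast
    \<comment> \<open>Half the distance from \<open>q\<close> to the nearer slope: an error of \<open>\<eta>\<close> in either slope keeps it on its side of \<open>q\<close>.\<close>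
    define \<eta> where "\<eta> = min (q - e \<bullet> G x z) (e \<bullet> G x w - q) / 2"
    have "\<eta> > 0"
      using q by (simp add: \<eta>_def)
    have zwZ: "z \<in> Z" "b x z = minval x" "w \<in> Z" "b x w = minval x"
      using zw by (auto simp: minimizers_def)
    obtain r where r: "r > 0" "ball x r \<subseteq> X"
      using x mem_interior by blast
    obtain d where d: "d > 0" "\<And>y v. y \<in> X \<Longrightarrow> v \<in> Z \<Longrightarrow> dist y x < d \<Longrightarrow>
        \<bar>b y v - b x v - (y - x) \<bullet> G x v\<bar> \<le> \<eta> * norm (y - x)"
      using uniform_gderiv[OF x \<open>\<eta> > 0\<close>] by auto
    have "\<phi> q u < \<phi> q t" if u: "u \<noteq> t" "\<bar>u - t\<bar> < min d r" for u
    proof -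
      define y where "y = x0 + u *\<^sub>R e"
      have yx: "y - x = (u - t) *\<^sub>R e"
        by (simp add: y_def x_def algebra_simps)
      then have nyx: "norm (y - x) = \<bar>u - t\<bar>"
        using e by simp
      then have "y \<in> ball x r" and dyx: "dist y x < d"
        using u by (auto simp: dist_norm norm_minus_commute)
      then have y: "y \<in> X"
        using r(2) by blast
      have bound: "minval y \<le> minval x + (u - t) * (e \<bullet> G x v) + \<eta> * \<bar>u - t\<bar>" if "v \<in> Z" "b x v = minval x" for v
        using d(2)[OF y that(1) dyx] minval_le[OF y that(1)] that(2) unfolding nyx
        by (simp add: yx abs_le_iff)
      have "minval y < minval x + q * (u - t)"
      proof (cases "t < u")
        case True
        have "e \<bullet> G x z + \<eta> < q"
          using \<open>\<eta> > 0\<close> by (simp add: \<eta>_def min_def field_simps split: if_splits)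
        then have "(u - t) * (e \<bullet> G x z + \<eta>) < (u - t) * q"
          using True by simp
        then show ?thesis
          using bound[OF zwZ(1,2)] True by (simp add: algebra_simps)
      next
        case False
        then have "u < t"
          using u by simp
        have "q < e \<bullet> G x w - \<eta>"
          using \<open>\<eta> > 0\<close> by (simp add: \<eta>_def min_def field_simps split: if_splits)
        then have "(u - t) * (e \<bullet> G x w - \<eta>) < (u - t) * q"
          using \<open>u < t\<close> by simp
        then show ?thesis
          using bound[OF zwZ(3,4)] \<open>u < t\<close> by (simp add: algebra_simps)
      qed
      then show ?thesis
        by (simp add: \<phi>_def x_def y_def algebra_simps)
    qed
    then have "\<exists>d>0. \<forall>u. u \<noteq> t \<and> \<bar>u - t\<bar> < d \<longrightarrow> \<phi> q u < \<phi> q t"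
      using d(1) r(1) by (intro exI[of _ "min d r"]) auto
    then show "t \<in> (\<Union>q\<in>\<rat>. {t. \<exists>d>0. \<forall>u. u \<noteq> t \<and> \<bar>u - t\<bar> < d \<longrightarrow> \<phi> q u < \<phi> q t})"
      using q(1) by blast
  qed
  moreover have "countable (\<Union>q\<in>\<rat>. {t. \<exists>d>0. \<forall>u. u \<noteq> t \<and> \<bar>u - t\<bar> < d \<longrightarrow> \<phi> q u < \<phi> q t})"
    by (intro countable_UN countable_rat countable_strict_local_maxima)
  ultimately show "countable {t. x0 + t *\<^sub>R e \<in> ?B}"
    by (rule countable_subset)
qed

lemma null_sets_nonunique_gradient:
  "{x \<in> interior X. \<exists>z\<in>minimizers x. \<exists>w\<in>minimizers x. G x z \<noteq> G x w} \<in> null_sets lborel"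
proof -
  have "{x \<in> interior X. \<exists>z\<in>minimizers x. \<exists>w\<in>minimizers x. G x z \<noteq> G x w} =
    (\<Union>e\<in>Basis. {x \<in> interior X. \<exists>z\<in>minimizers x. \<exists>w\<in>minimizers x. e \<bullet> G x z < e \<bullet> G x w})" (is "?L = ?R")
  proof (intro equalityI subsetI)
    fix x assume x: "x \<in> ?L"
    then obtain z w where zw: "z \<in> minimizers x" "w \<in> minimizers x" "G x z \<noteq> G x w"
      by blast
    then obtain e where "e \<in> Basis" "e \<bullet> G x z \<noteq> e \<bullet> G x w"
      by (metis euclidean_eq_iff inner_commute)
    then show "x \<in> ?R"
      using x zw by (cases "e \<bullet> G x z < e \<bullet> G x w") (auto, meson linorder_neqE)
  next
    fix x assume "x \<in> ?R"
    then show "x \<in> ?L"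
      by (smt (verit) UN_E mem_Collect_eq)
  qed
  also have "\<dots> \<in> null_sets lborel"
    by (intro null_sets_UN' null_sets_nonunique_slope countable_finite finite_Basis) simp
  finally show ?thesis .
qed

end

section \<open>Products of compact domains and gradients up to the boundary\<close>

text \<open>
  The topology of the function type is the product topology over all indices.  An extensional product is a full
  product whose remaining factors are the singleton \<open>{undefined}\<close>, and so facts about full products apply.
\<close>
lemma PiE_eq_PiE_UNIV: "Pi\<^sub>E I D = Pi\<^sub>E UNIV (\<lambda>i. if i \<in> I then D i else {undefined})"
  by (auto simp: PiE_def Pi_def extensional_def split: if_splits)

lemma compact_PiE:
  fixes D :: "'i \<Rightarrow> 'b::topological_space set"
  assumes "\<And>i. i \<in> I \<Longrightarrow> compact (D i)"
  shows "compact (Pi\<^sub>E I D)"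
proof -
  have "compactin (product_topology (\<lambda>_. euclidean) UNIV)
      (Pi\<^sub>E UNIV (\<lambda>i. if i \<in> I then D i else {undefined}))"
    using assms by (subst compactin_PiE) auto
  then show ?thesis
    unfolding PiE_eq_PiE_UNIV[of I] euclidean_product_topology by simp
qed

lemma closure_PiE:
  fixes S :: "'i \<Rightarrow> 'b::t1_space set"
  shows "closure (Pi\<^sub>E I S) = Pi\<^sub>E I (\<lambda>i. closure (S i))"
proof -
  have "closure (Pi\<^sub>E I S) = euclidean closure_of (Pi\<^sub>E UNIV (\<lambda>i. if i \<in> I then S i else {undefined}))"
    unfolding PiE_eq_PiE_UNIV[of I S] by simp
  also have "\<dots> = Pi\<^sub>E UNIV (\<lambda>i. euclidean closure_of (if i \<in> I then S i else {undefined}))"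
    unfolding euclidean_product_topology[symmetric] by (rule closure_of_product_topology)
  also have "\<dots> = Pi\<^sub>E UNIV (\<lambda>i. if i \<in> I then closure (S i) else {undefined})"
    by (intro PiE_cong) auto
  also have "\<dots> = Pi\<^sub>E I (\<lambda>i. closure (S i))"
    by (rule PiE_eq_PiE_UNIV[symmetric])
  finally show ?thesis .
qed

lemma continuous_on_fun_upd:
  fixes g :: "'a::topological_space \<Rightarrow> 'i \<Rightarrow> 'b::topological_space"
  assumes "continuous_on S g" "continuous_on S f"
  shows "continuous_on S (\<lambda>p. (g p)(i := f p))"
proof (rule continuous_on_coordinatewise_then_product)
  fix j show "continuous_on S (\<lambda>p. ((g p)(i := f p)) j)"
    using assms continuous_on_product_then_coordinatewise[OF assms(1), of j] by (cases "j = i") auto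
qed

text \<open>
  For \<open>z\<close> in \<open>Z0\<close>, the mean value inequality bounds the error of the first-order expansion by the oscillation of
  \<open>G\<close>, which is small uniformly in \<open>z\<close> by compactness.  The resulting inequality is closed in \<open>z\<close>, so it extends
  to \<open>closure Z0\<close>.  In the application \<open>Z0\<close> consists of the interior points, where the gradient of the cost is a
  genuine one.
\<close>
lemma uniform_gderiv_closure:
  fixes X :: "'a::euclidean_space set" and Z :: "'b::metric_space set"
  assumes X: "compact X" and Z: "compact Z" "Z = closure Z0"
    and b: "continuous_on (X \<times> Z) (\<lambda>(x, z). b x z)"
    and G: "continuous_on (X \<times> Z) (\<lambda>(x, z). G x z)"
    and deriv: "\<And>x z. x \<in> interior X \<Longrightarrow> z \<in> Z0 \<Longrightarrow> GDERIV (\<lambda>y. b y z) x :> G x z"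
    and x: "x \<in> interior X" and "e > 0"
  shows "\<exists>d>0. \<forall>y\<in>X. \<forall>z\<in>Z. dist y x < d \<longrightarrow> \<bar>b y z - b x z - (y - x) \<bullet> G x z\<bar> \<le> e * norm (y - x)"
proof -
  have "uniformly_continuous_on (X \<times> Z) (\<lambda>(x, z). G x z)"
    using G X Z(1) by (intro compact_uniformly_continuous compact_Times)
  then obtain d where "d > 0" and d: "\<And>p q. p \<in> X \<times> Z \<Longrightarrow> q \<in> X \<times> Z \<Longrightarrow> dist q p < d \<Longrightarrow>
      dist ((\<lambda>(x, z). G x z) q) ((\<lambda>(x, z). G x z) p) < e"
    using \<open>e > 0\<close> unfolding uniformly_continuous_on_def by metis
  obtain r where r: "r > 0" "ball x r \<subseteq> interior X"
    using x open_interior open_contains_ball by blast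
  have rX: "ball x r \<subseteq> X" and xX: "x \<in> X"
    using r(2) x interior_subset by blast+
  have bound: "\<bar>b y z - b x z - (y - x) \<bullet> G x z\<bar> \<le> e * norm (y - x)"
    if y: "y \<in> ball x (min d r)" and z: "z \<in> Z0" for y z
  proof -
    have "norm (b y z - b x z - (\<lambda>h. h \<bullet> G x z) (y - x)) \<le> norm (y - x) * e"
    proof (rule differentiable_bound_linearization[where S = "ball x (min d r)" and f' = "\<lambda>u h. h \<bullet> G u z"])
      have cx: "x \<in> ball x (min d r)"
        using \<open>d > 0\<close> r(1) by simp
      then have "closed_segment x y \<subseteq> ball x (min d r)"
        using y by (intro closed_segment_subset convex_ball)
      then show "x + t *\<^sub>R (y - x) \<in> ball x (min d r)" if "t \<in> {0..1}" for t
        using that by (force simp: closed_segment_def algebra_simps)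
      show "((\<lambda>y. b y z) has_derivative (\<lambda>h. h \<bullet> G u z)) (at u within ball x (min d r))"
        if u: "u \<in> ball x (min d r)" for u
      proof (rule has_derivative_at_withinI)
        have "u \<in> interior X"
          using u r(2) by auto
        from deriv[OF this z] show "((\<lambda>y. b y z) has_derivative (\<lambda>h. h \<bullet> G u z)) (at u)"
          by (simp add: gderiv_def)
      qed
      show "onorm ((\<lambda>h. h \<bullet> G u z) - (\<lambda>h. h \<bullet> G x z)) \<le> e" if u: "u \<in> ball x (min d r)" for u
        unfolding fun_diff_def
      proof (rule onorm_le)
        fix h :: 'a
        have "z \<in> Z"
          using z Z(2) closure_subset by blast
        moreover have "u \<in> X" "dist u x < d"
          using u rX by (auto simp: dist_commute)
        ultimately have "norm (G u z - G x z) \<le> e"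
          using d[of "(x, z)" "(u, z)"] xX by (simp add: dist_Pair_Pair dist_norm)
        then have "norm h * norm (G u z - G x z) \<le> norm h * e"
          by (intro mult_left_mono) auto
        then have "\<bar>h \<bullet> (G u z - G x z)\<bar> \<le> norm h * e"
          using Cauchy_Schwarz_ineq2[of h "G u z - G x z"] by linarith
        then show "norm (h \<bullet> G u z - h \<bullet> G x z) \<le> e * norm h"
          by (simp add: inner_diff_right mult.commute)
      qed
      show "x \<in> ball x (min d r)"
        by (fact cx)
    qed
    then show ?thesis
      by (simp add: mult.commute)
  qed
  show ?thesis
  proof (intro exI[of _ "min d r"] conjI ballI impI)
    show "min d r > 0"
      using \<open>d > 0\<close> r(1) by simp
    fix y z assume y: "y \<in> X" "dist y x < min d r" and z: "z \<in> Z"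
    have "continuous_on Z (\<lambda>z. (v, z))" for v :: 'a
      by (intro continuous_intros)
    then have "continuous_on Z (b y)" "continuous_on Z (b x)" "continuous_on Z (G x)"
      using continuous_on_compose2[OF b, of Z "\<lambda>z. (y, z)"] continuous_on_compose2[OF b, of Z "\<lambda>z. (x, z)"]
        continuous_on_compose2[OF G, of Z "\<lambda>z. (x, z)"] y xX
      by (auto simp: image_subset_iff)
    then have "closed {z \<in> Z. \<bar>b y z - b x z - (y - x) \<bullet> G x z\<bar> \<le> e * norm (y - x)}"
      using compact_imp_closed[OF Z(1)]
      by (intro continuous_on_closed_Collect_le continuous_intros)
    moreover have "Z0 \<subseteq> {z \<in> Z. \<bar>b y z - b x z - (y - x) \<bullet> G x z\<bar> \<le> e * norm (y - x)}"
      using bound[of y] y Z(2) closure_subset by (auto simp: dist_commute)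
    ultimately have "closure Z0 \<subseteq> {z \<in> Z. \<bar>b y z - b x z - (y - x) \<bullet> G x z\<bar> \<le> e * norm (y - x)}"
      by (rule closure_minimal[rotated])
    then show "\<bar>b y z - b x z - (y - x) \<bullet> G x z\<bar> \<le> e * norm (y - x)"
      using z Z(2) by blast
  qed
qed

lemma compact_domain_imp_compact: "compact_domain D \<Longrightarrow> compact D"
  by (auto simp: compact_domain_def)

lemma compact_domain_nonempty: "compact_domain D \<Longrightarrow> D \<noteq> {}"
  by (auto simp: compact_domain_def)

lemma compact_domain_eq_closure_interior:
  assumes "compact_domain D"
  shows "D = closure (interior D)"
proof -
  obtain U where U: "open U" "D = closure U"
    using assms by (auto simp: compact_domain_def)
  have "U \<subseteq> interior D"
    unfolding U(2) by (rule interior_maximal[OF closure_subset U(1)])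
  then have "D \<subseteq> closure (interior D)"
    unfolding U(2) by (rule closure_mono)
  moreover have "closure (interior D) \<subseteq> D"
    using U(2) by (intro closure_minimal interior_subset) simp
  ultimately show ?thesis
    by blast
qed

section \<open>Measures and their completions\<close>

lemma sets_completion_cong_AE:
  assumes A: "A \<in> sets (completion M)" and B: "B \<subseteq> space M" and AE: "AE x in M. x \<in> A \<longleftrightarrow> x \<in> B"
  shows "B \<in> sets (completion M)"
proof -
  have "AE x in M. \<not> (x \<in> A \<and> x \<notin> B)" "AE x in M. \<not> (x \<notin> A \<and> x \<in> B)"
    using AE by (auto elim: eventually_mono)
  from this[THEN sets_completion_AE]
  have "{x \<in> space (completion M). x \<in> A \<and> x \<notin> B} \<in> sets (completion M)"
    "{x \<in> space (completion M). x \<notin> A \<and> x \<in> B} \<in> sets (completion M)"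
    by (simp_all only: pred_def)
  then have "A - {x \<in> space (completion M). x \<in> A \<and> x \<notin> B} \<union> {x \<in> space (completion M). x \<notin> A \<and> x \<in> B}
      \<in> sets (completion M)"
    using A by blast
  moreover have "B = A - {x \<in> space (completion M). x \<in> A \<and> x \<notin> B} \<union> {x \<in> space (completion M). x \<notin> A \<and> x \<in> B}"
    using B sets.sets_into_space[OF A] by auto
  ultimately show ?thesis
    by simp
qed

lemma measurable_completion_cong_AE:
  assumes f: "f \<in> completion M \<rightarrow>\<^sub>M N" and g: "g \<in> space M \<rightarrow> space N" and AE: "AE x in M. f x = g x"
  shows "g \<in> completion M \<rightarrow>\<^sub>M N"
proof (rule measurableI)
  fix E assume E: "E \<in> sets N"
  show "g -` E \<inter> space (completion M) \<in> sets (completion M)"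
  proof (rule sets_completion_cong_AE[OF measurable_sets[OF f E]])
    show "AE x in M. x \<in> f -` E \<inter> space (completion M) \<longleftrightarrow> x \<in> g -` E \<inter> space (completion M)"
      using AE by eventually_elim simp
  qed simp
qed (use g in auto)

text \<open>
  The indicator of a nonempty closed set \<open>C\<close> is the limit of the continuous functions
  \<open>x \<mapsto> max 0 (1 - n * infdist x C)\<close>, and closed sets form a generator of the Borel sets that is stable under
  intersection.
\<close>
lemma measure_eqI_continuous_integrals:
  fixes M M' :: "'a::metric_space measure"
  assumes fin: "finite_measure M" "finite_measure M'" and sets: "sets M = sets borel" "sets M' = sets borel"
    and eq: "\<And>h. continuous_on UNIV h \<Longrightarrow> (\<And>x. \<bar>h x\<bar> \<le> 1) \<Longrightarrow> (\<integral>x. h x \<partial>M) = (\<integral>x. (h x :: real) \<partial>M')"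
  shows "M = M'"
proof (rule measure_eqI_generator_eq[where E = "Collect closed" and \<Omega> = UNIV and A = "\<lambda>_. UNIV"])
  interpret M: finite_measure M by fact
  interpret M': finite_measure M' by fact
  have space: "space M = UNIV" "space M' = UNIV"
    using sets_eq_imp_space_eq[OF sets(1)] sets_eq_imp_space_eq[OF sets(2)] by auto
  show "Int_stable (Collect closed :: 'a set set)"
    by (auto simp: Int_stable_def)
  show "sets M = sigma_sets UNIV (Collect closed)" "sets M' = sigma_sets UNIV (Collect closed)"
    unfolding sets borel_eq_closed by simp_all
  show "emeasure M C = emeasure M' C" if "C \<in> Collect closed" for C
  proof (cases "C = {}")
    case False
    have C: "closed C"
      using that by simp
    define h where "h = (\<lambda>n x. max 0 (1 - real n * infdist x C))"
    have h: "continuous_on UNIV (h n)" "\<bar>h n x\<bar> \<le> 1" for n x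
      using infdist_nonneg[of x C] unfolding h_def by (auto intro!: continuous_intros simp: abs_le_iff)
    have lim: "(\<lambda>n. h n x) \<longlonglongrightarrow> indicator C x" for x
    proof (cases "x \<in> C")
      case True
      then show ?thesis
        by (simp add: h_def)
    next
      case False
      then have "infdist x C > 0"
        using C \<open>C \<noteq> {}\<close> by (metis in_closed_iff_infdist_zero infdist_nonneg less_eq_real_def)
      then obtain n0 where "1 < real n0 * infdist x C"
        using reals_Archimedean3 by blast
      then have "1 < real n * infdist x C" if "n \<ge> n0" for n
        using that \<open>infdist x C > 0\<close> by (meson less_le_trans mult_right_mono of_nat_mono less_imp_le)
      then have "h n x = 0" if "n \<ge> n0" for n
        using that unfolding h_def by force
      then show ?thesis
        using False by (intro tendsto_eventually eventually_sequentiallyI[of n0]) simp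
    qed
    have conv: "(\<lambda>n. \<integral>x. h n x \<partial>K) \<longlonglongrightarrow> measure K C" if "finite_measure K" "sets K = sets borel" for K
    proof -
      interpret K: finite_measure K by fact
      have "space K = UNIV"
        using sets_eq_imp_space_eq[OF that(2)] by simp
      have "(\<lambda>n. \<integral>x. h n x \<partial>K) \<longlonglongrightarrow> (\<integral>x. indicator C x \<partial>K)"
      proof (rule integral_dominated_convergence[where w = "\<lambda>_. 1"])
        show "indicator C \<in> borel_measurable K" "h n \<in> borel_measurable K" for n
          using C borel_measurable_continuous_onI[OF h(1), of n]
          by (auto simp: measurable_cong_sets[OF that(2) refl])
      qed (use h lim in auto)
      then show ?thesis
        using \<open>space K = UNIV\<close> by simp
    qed
    have "(\<lambda>n. \<integral>x. h n x \<partial>M) = (\<lambda>n. \<integral>x. h n x \<partial>M')"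
      using eq[OF h] by simp
    then have "measure M C = measure M' C"
      using conv[OF fin(1) sets(1)] conv[OF fin(2) sets(2)] LIMSEQ_unique by metis
    then show ?thesis
      by (simp add: M.emeasure_eq_measure M'.emeasure_eq_measure)
  qed simp
qed (use fin in \<open>auto simp: finite_measure.emeasure_finite\<close>)

lemma borel_measurable_continuous_finite_borel_measure_on:
  assumes "finite_borel_measure_on D \<mu>" "continuous_on D u"
  shows "u \<in> borel_measurable \<mu>"
proof -
  have "u \<in> borel_measurable (restrict_space borel D)"
    using assms(2) by (rule borel_measurable_continuous_on_restrict)
  then show ?thesis
    using assms(1) measurable_cong_sets[of \<mu> "restrict_space borel D"] by (auto simp: finite_borel_measure_on_def)
qed

lemma integrable_continuous_finite_borel_measure_on:
  fixes u :: "'a::euclidean_space \<Rightarrow> real"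
  assumes "finite_borel_measure_on D \<mu>" "continuous_on D u" "compact D"
  shows "integrable \<mu> u"
proof -
  interpret finite_measure \<mu>
    using assms(1) by (simp add: finite_borel_measure_on_def)
  obtain B where "\<And>x. x \<in> D \<Longrightarrow> norm (u x) \<le> B"
    using compact_imp_bounded[OF compact_continuous_image[OF assms(2,3)]] by (auto simp: bounded_iff)
  then have "AE x in \<mu>. norm (u x) \<le> B"
    using assms(1) by (auto simp: finite_borel_measure_on_def)
  then show ?thesis
    by (rule integrable_const_bound) (rule borel_measurable_continuous_finite_borel_measure_on[OF assms(1,2)])
qed

section \<open>Conjugate potentials that maximize the dual functional\<close>

declare One_nat_def [simp del]

text \<open>
  The hypotheses on the cost, the marginals and the potentials that determine the set of minimizers; a
  map of the Monge problem enters only afterwards.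
\<close>
locale conjugate_potentials =
  fixes N :: nat
    and D :: "nat \<Rightarrow> (real ^ 'n) set"
    and \<mu> :: "nat \<Rightarrow> (real ^ 'n) measure"
    and c :: "(nat \<Rightarrow> real ^ 'n) \<Rightarrow> real"
    and grad_c :: "nat \<Rightarrow> (nat \<Rightarrow> real ^ 'n) \<Rightarrow> real ^ 'n"
    and f :: "nat \<Rightarrow> real ^ 'n \<Rightarrow> real"
  assumes N: "N \<ge> 2"
    and domain: "\<And>i. i \<in> {1..N} \<Longrightarrow> compact_domain (D i)"
    and borel_measure: "\<And>i. i \<in> {1..N} \<Longrightarrow> finite_borel_measure_on (D i) (\<mu> i)"
    and null_frontier: "emeasure (\<mu> 1) (frontier (D 1)) = 0"
    and C1: "C1_cost N D c grad_c"
    and twist: "\<And>x. x \<in> D 1 \<Longrightarrow> inj_on (\<lambda>z. grad_c 1 (z(1 := x))) (Pi\<^sub>E {2..N} D)"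
    and conjugate: "c_conjugate N D c f"
    and maximizer: "dual_maximizer N D \<mu> c f"
    and differentiable_AE: "absolutely_continuous (restrict_space lborel (D 1)) (\<mu> 1) \<or>
         (AE x in \<mu> 1. f 1 differentiable (at x))"
begin

definition Z :: "(nat \<Rightarrow> real ^ 'n) set" where
  "Z = Pi\<^sub>E {2..N} D"

text \<open>
  The function minimized by the \<open>c\<close>-transform that defines \<open>f 1\<close>.
\<close>
definition reduced_cost :: "real ^ 'n \<Rightarrow> (nat \<Rightarrow> real ^ 'n) \<Rightarrow> real" where
  "reduced_cost x z = c (z(1 := x)) - (\<Sum>k=2..N. f k (z k))"

lemma mem_1N: "1 \<in> {1..N}" and atLeast1: "{1..N} = insert 1 {2..N}" and not_mem_2N: "1 \<notin> {2..N}"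
  using N by auto

lemma continuous_f: "k \<in> {1..N} \<Longrightarrow> continuous_on (D k) (f k)"
  using maximizer by (auto simp: dual_maximizer_def admissible_class_def)

lemma compact_D: "k \<in> {1..N} \<Longrightarrow> compact (D k)"
  using domain compact_domain_imp_compact by blast

lemma update_mem: "x \<in> D 1 \<Longrightarrow> z \<in> Z \<Longrightarrow> z(1 := x) \<in> Pi\<^sub>E {1..N} D"
  unfolding Z_def atLeast1 by (rule PiE_fun_upd)

lemma coordinate_mem: "z \<in> Z \<Longrightarrow> k \<in> {2..N} \<Longrightarrow> z k \<in> D k"
  by (auto simp: Z_def)

lemma compact_Z: "compact Z"
  unfolding Z_def
proof (rule compact_PiE)
  show "compact (D k)" if "k \<in> {2..N}" for k
    using that by (intro compact_D) simp
qed

lemma Z_nonempty: "Z \<noteq> {}"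
proof -
  have "D k \<noteq> {}" if "k \<in> {2..N}" for k
    using that by (intro compact_domain_nonempty domain) simp
  then show ?thesis
    unfolding Z_def PiE_eq_empty_iff by blast
qed

lemma continuous_update:
  assumes u: "continuous_on (Pi\<^sub>E {1..N} D) u"
  shows "continuous_on (D 1 \<times> Z) (\<lambda>(x, z). u (z(1 := x)))"
proof -
  have "continuous_on (D 1 \<times> Z) (\<lambda>p. u ((snd p)(1 := fst p)))"
  proof (rule continuous_on_compose2[OF u])
    show "continuous_on (D 1 \<times> Z) (\<lambda>p. (snd p)(1 := fst p))"
      by (intro continuous_on_fun_upd continuous_on_fst continuous_on_snd continuous_on_id)
    show "(\<lambda>p. (snd p)(1 := fst p)) ` (D 1 \<times> Z) \<subseteq> Pi\<^sub>E {1..N} D"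
      by (intro image_subsetI update_mem) (simp_all add: mem_Times_iff)
  qed
  then show ?thesis
    by (simp add: case_prod_beta')
qed

lemma continuous_coordinate:
  assumes "k \<in> {2..N}" "continuous_on (D k) u"
  shows "continuous_on Z (\<lambda>z. u (z k))"
proof (rule continuous_on_compose2[OF assms(2)])
  show "continuous_on Z (\<lambda>z. z k)"
    by (rule continuous_on_subset[OF continuous_on_product_coordinates]) simp
  show "(\<lambda>z. z k) ` Z \<subseteq> D k"
    using assms(1) coordinate_mem by blast
qed

lemma continuous_reduced_cost: "continuous_on (D 1 \<times> Z) (\<lambda>(x, z). reduced_cost x z)"
proof -
  have "continuous_on (D 1 \<times> Z) (\<lambda>p. f k (snd p k))" if "k \<in> {2..N}" for k
    using that
    by (intro continuous_on_compose2[OF continuous_coordinate[OF that continuous_f], of _ snd]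
          continuous_intros) auto
  moreover have "continuous_on (D 1 \<times> Z) (\<lambda>p. c ((snd p)(1 := fst p)))"
    using continuous_update[of c] C1 by (simp add: C1_cost_def case_prod_beta')
  ultimately show ?thesis
    unfolding reduced_cost_def case_prod_beta' by (intro continuous_intros)
qed

lemma Z_eq_closure: "Z = closure (Pi\<^sub>E {2..N} (\<lambda>k. interior (D k)))"
  unfolding Z_def closure_PiE
proof (rule PiE_cong)
  show "D k = closure (interior (D k))" if "k \<in> {2..N}" for k
    using that by (intro compact_domain_eq_closure_interior domain) simp
qed

sublocale differentiable_minimization "D 1" Z reduced_cost "\<lambda>x z. grad_c 1 (z(1 := x))"
proof
  show "compact (D 1)" "compact Z" "Z \<noteq> {}"
    using compact_D mem_1N compact_Z Z_nonempty by blast+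
  show "continuous_on (D 1 \<times> Z) (\<lambda>(x, z). reduced_cost x z)"
    by (fact continuous_reduced_cost)
  show G: "continuous_on (D 1 \<times> Z) (\<lambda>(x, z). grad_c 1 (z(1 := x)))"
    using C1 mem_1N by (intro continuous_update) (auto simp: C1_cost_def)
  show "\<exists>d>0. \<forall>y\<in>D 1. \<forall>z\<in>Z. dist y x < d \<longrightarrow>
      \<bar>reduced_cost y z - reduced_cost x z - (y - x) \<bullet> grad_c 1 (z(1 := x))\<bar> \<le> e * norm (y - x)"
    if "x \<in> interior (D 1)" "e > 0" for x e
  proof (rule uniform_gderiv_closure[OF _ compact_Z Z_eq_closure continuous_reduced_cost G _ that])
    show "compact (D 1)"
      using compact_D mem_1N by blast
    fix x z assume x: "x \<in> interior (D 1)" and z: "z \<in> Pi\<^sub>E {2..N} (\<lambda>k. interior (D k))"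
    have "z(1 := x) \<in> Pi\<^sub>E {1..N} (\<lambda>k. interior (D k))"
      using x z unfolding atLeast1 by (auto simp: PiE_def extensional_def)
    then have "GDERIV (\<lambda>y. c (z(1 := x, 1 := y))) ((z(1 := x)) 1) :> grad_c 1 (z(1 := x))"
      using C1 mem_1N unfolding C1_cost_def by blast
    then have "((\<lambda>y. c (z(1 := y)) - (\<Sum>k=2..N. f k (z k))) has_derivative
        (\<lambda>h. h \<bullet> grad_c 1 (z(1 := x)) - 0)) (at x)"
      unfolding gderiv_def by (intro derivative_intros) simp
    then show "GDERIV (\<lambda>y. reduced_cost y z) x :> grad_c 1 (z(1 := x))"
      by (simp add: gderiv_def reduced_cost_def)
  qed
qed

lemma f1_eq_minval: "x \<in> D 1 \<Longrightarrow> f 1 x = minval x"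
proof -
  assume "x \<in> D 1"
  moreover have "{1..N} - {1} = {2..N}"
    by auto
  ultimately show ?thesis
    using conjugate mem_1N unfolding minval_def by (simp add: c_conjugate_def c_transform_def reduced_cost_def Z_def)
qed

lemma space_mu: "k \<in> {1..N} \<Longrightarrow> space (\<mu> k) = D k"
  and sets_mu: "k \<in> {1..N} \<Longrightarrow> sets (\<mu> k) = sets (restrict_space borel (D k))"
  and finite_mu: "k \<in> {1..N} \<Longrightarrow> finite_measure (\<mu> k)"
  using borel_measure[of k] by (simp_all add: finite_borel_measure_on_def)

lemma borel_D: "k \<in> {1..N} \<Longrightarrow> D k \<in> sets borel"
  by (intro borel_closed compact_imp_closed compact_D)

lemma sets_mu_iff:
  assumes "k \<in> {1..N}"
  shows "E \<in> sets (\<mu> k) \<longleftrightarrow> E \<subseteq> D k \<and> E \<in> sets borel"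
  unfolding sets_mu[OF assms] using borel_D[OF assms] by (intro sets_restrict_space_iff) simp

lemma AE_interior: "AE x in \<mu> 1. x \<in> interior (D 1)"
proof (rule AE_I')
  have "closed (D 1)"
    using compact_D mem_1N compact_imp_closed by blast
  then have "frontier (D 1) \<in> sets (\<mu> 1)"
    using mem_1N by (simp add: sets_mu_iff frontier_subset_closed)
  then show "frontier (D 1) \<in> null_sets (\<mu> 1)"
    using null_frontier by auto
  show "{x \<in> space (\<mu> 1). x \<notin> interior (D 1)} \<subseteq> frontier (D 1)"
    using \<open>closed (D 1)\<close> mem_1N by (auto simp: space_mu frontier_def)
qed

text \<open>
  This is the point where injectivity of the gradient of the cost enters.
\<close>
lemma is_singleton_minimizers:
  assumes x: "x \<in> D 1"
    and G: "\<And>z w. z \<in> minimizers x \<Longrightarrow> w \<in> minimizers x \<Longrightarrow> grad_c 1 (z(1 := x)) = grad_c 1 (w(1 := x))"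
  shows "is_singleton (minimizers x)"
proof (rule is_singletonI')
  show "minimizers x \<noteq> {}"
    using x by (rule minimizers_nonempty)
  show "z = w" if "z \<in> minimizers x" "w \<in> minimizers x" for z w
    using inj_onD[OF twist[OF x], of z w] G[OF that] that minimizer_in_Z by (simp add: Z_def)
qed

lemma AE_unique_minimizer: "AE x in \<mu> 1. is_singleton (minimizers x)"
  using differentiable_AE
proof
  define B where "B = {x \<in> interior (D 1).
    \<exists>z\<in>minimizers x. \<exists>w\<in>minimizers x. grad_c 1 (z(1 := x)) \<noteq> grad_c 1 (w(1 := x))}"
  assume "absolutely_continuous (restrict_space lborel (D 1)) (\<mu> 1)"
  moreover have "B \<in> null_sets (restrict_space lborel (D 1))"
    using null_sets_nonunique_gradient interior_subset[of "D 1"] borel_D[OF mem_1N]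
    by (subst null_sets_restrict_space) (auto simp: B_def)
  ultimately have "B \<in> null_sets (\<mu> 1)"
    by (auto simp: absolutely_continuous_def)
  then have "AE x in \<mu> 1. x \<notin> B"
    by (rule AE_not_in)
  then show ?thesis
    using AE_interior
  proof eventually_elim
    case (elim x)
    show ?case
    proof (rule is_singleton_minimizers)
      show "x \<in> D 1"
        using elim(2) interior_subset by blast
      show "grad_c 1 (z(1 := x)) = grad_c 1 (w(1 := x))" if "z \<in> minimizers x" "w \<in> minimizers x" for z w
        using elim that unfolding B_def by blast
    qed
  qed
next
  assume "AE x in \<mu> 1. f 1 differentiable (at x)"
  then show ?thesis
    using AE_interior
  proof eventually_elim
    case (elim x)
    show ?case
    proof (rule is_singleton_minimizers)
      show "x \<in> D 1"
        using elim(2) interior_subset by blast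
      show "grad_c 1 (z(1 := x)) = grad_c 1 (w(1 := x))" if "z \<in> minimizers x" "w \<in> minimizers x" for z w
        using gradient_unique_if_differentiable[OF elim(2) f1_eq_minval elim(1) that] .
    qed
  qed
qed

lemma integrable_continuous:
  fixes u :: "real ^ 'n \<Rightarrow> real"
  assumes "k \<in> {1..N}" "continuous_on (D k) u"
  shows "integrable (\<mu> k) u"
  using integrable_continuous_finite_borel_measure_on[OF borel_measure assms(2) compact_D] assms(1)
  by blast

lemma mem_1N_if_2N: "k \<in> {2..N} \<Longrightarrow> k \<in> {1..N}"
  by simp

lemma sum_split_first: "(\<Sum>k=1..N. g k) = g 1 + (\<Sum>k=2..N. g k)"
  for g :: "nat \<Rightarrow> real"
  unfolding atLeast1 using not_mem_2N by (subst sum.insert) auto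

section \<open>The first variation of the dual functional\<close>

lemma continuous_perturbed:
  assumes j: "j \<in> {2..N}" and h: "continuous_on (D j) h"
  shows "continuous_on (D 1) (\<lambda>x. INF w\<in>Z. reduced_cost x w - t * h (w j))"
    and "x \<in> D 1 \<Longrightarrow> w \<in> Z \<Longrightarrow> (INF w\<in>Z. reduced_cost x w - t * h (w j)) \<le> reduced_cost x w - t * h (w j)"
proof -
  have "continuous_on (D 1 \<times> Z) (\<lambda>p. h (snd p j))"
  proof (rule continuous_on_compose2[OF continuous_coordinate[OF assms]])
    show "continuous_on (D 1 \<times> Z) snd"
      by (intro continuous_intros)
  qed auto
  then have "continuous_on (D 1 \<times> Z) (\<lambda>(x, w). reduced_cost x w - t * h (w j))"
    unfolding case_prod_beta' by (intro continuous_intros) auto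
  then interpret P: compact_minimization "D 1" Z "\<lambda>x w. reduced_cost x w - t * h (w j)"
    using compact_X compact_Z Z_nonempty by unfold_locales
  show "continuous_on (D 1) (\<lambda>x. INF w\<in>Z. reduced_cost x w - t * h (w j))"
    using P.continuous_minval unfolding P.minval_def .
  show "x \<in> D 1 \<Longrightarrow> w \<in> Z \<Longrightarrow> (INF w\<in>Z. reduced_cost x w - t * h (w j)) \<le> reduced_cost x w - t * h (w j)"
    using P.minval_le unfolding P.minval_def .
qed

text \<open>
  Raising \<open>f j\<close> by \<open>t * h\<close> and lowering \<open>f 1\<close> to the transform of the new potentials gives an admissible family.
  Its dual value is at most that of \<open>f\<close>, so the gain in the \<open>j\<close>-th integral does not exceed the loss in the
  first.
\<close>
lemma dual_first_variation:
  assumes j: "j \<in> {2..N}" and h: "continuous_on (D j) h"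
  shows "t * (\<integral>y. h y \<partial>\<mu> j) \<le> (\<integral>x. minval x - (INF w\<in>Z. reduced_cost x w - t * h (w j)) \<partial>\<mu> 1)"
proof -
  define P where "P = (\<lambda>x. INF w\<in>Z. reduced_cost x w - t * h (w j))"
  define g where "g = (\<lambda>k. if k = 1 then P else (\<lambda>y. f k y + (if k = j then t * h y else 0)))"
  have P: "continuous_on (D 1) P"
    unfolding P_def by (rule continuous_perturbed[OF assms])
  have g1: "g 1 = P" and gk: "\<And>k. k \<in> {2..N} \<Longrightarrow> g k = (\<lambda>y. f k y + (if k = j then t * h y else 0))"
    using not_mem_2N by (auto simp: g_def)
  have "g \<in> admissible_class N D c"
    unfolding admissible_class_def
  proof (intro CollectI conjI ballI)
    fix k assume k: "k \<in> {1..N}"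
    show "continuous_on (D k) (g k)"
    proof (cases "k = 1")
      case False
      then have "k \<in> {2..N}"
        using k unfolding atLeast1 by blast
      then show ?thesis
        unfolding gk[OF \<open>k \<in> {2..N}\<close>] using continuous_f[OF k] h
        by (cases "k = j") (auto intro!: continuous_intros)
    qed (use P g1 in simp)
  next
    fix p assume p: "p \<in> Pi\<^sub>E {1..N} D"
    define z where "z = restrict p {2..N}"
    have p1: "p 1 \<in> D 1"
      using p mem_1N by auto
    have z: "z \<in> Z"
      using p unfolding z_def Z_def atLeast1 by auto
    have pz: "p = z(1 := p 1)"
    proof
      fix i show "p i = (z(1 := p 1)) i"
        using p by (cases "i \<in> {2..N}") (auto simp: z_def PiE_def extensional_def)
    qed
    have "(\<Sum>k=2..N. g k (p k)) = (\<Sum>k=2..N. f k (z k) + (if k = j then t * h (z j) else 0))"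
      by (intro sum.cong) (auto simp: gk z_def)
    also have "\<dots> = (\<Sum>k=2..N. f k (z k)) + t * h (z j)"
      using j by (simp add: sum.distrib)
    finally have "(\<Sum>k=1..N. g k (p k)) = P (p 1) + (\<Sum>k=2..N. f k (z k)) + t * h (z j)"
      unfolding sum_split_first g1 by simp
    also have "P (p 1) \<le> reduced_cost (p 1) z - t * h (z j)"
      unfolding P_def by (rule continuous_perturbed(2)[OF assms p1 z])
    finally show "(\<Sum>k=1..N. g k (p k)) \<le> c p"
      using pz by (simp add: reduced_cost_def)
  qed
  then have "dual_functional N \<mu> g \<le> dual_functional N \<mu> f"
    using maximizer by (auto simp: dual_maximizer_def)
  moreover have "(\<integral>y. g k y \<partial>\<mu> k) = (\<integral>y. f k y \<partial>\<mu> k) + (if k = j then t * (\<integral>y. h y \<partial>\<mu> j) else 0)"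
    if "k \<in> {2..N}" for k
    unfolding gk[OF that]
    using integrable_continuous[OF mem_1N_if_2N[OF that] continuous_f[OF mem_1N_if_2N[OF that]]]
      integrable_continuous[OF mem_1N_if_2N[OF j] h]
    by auto
  then have "(\<Sum>k=2..N. \<integral>y. g k y \<partial>\<mu> k) =
      (\<Sum>k=2..N. (\<integral>y. f k y \<partial>\<mu> k) + (if k = j then t * (\<integral>y. h y \<partial>\<mu> j) else 0))"
    by (rule sum.cong[OF refl])
  then have "(\<Sum>k=2..N. \<integral>y. g k y \<partial>\<mu> k) = (\<Sum>k=2..N. \<integral>y. f k y \<partial>\<mu> k) + t * (\<integral>y. h y \<partial>\<mu> j)"
    using j by (simp add: sum.distrib)
  ultimately have "(\<integral>x. P x \<partial>\<mu> 1) + t * (\<integral>y. h y \<partial>\<mu> j) \<le> (\<integral>x. f 1 x \<partial>\<mu> 1)"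
    unfolding dual_functional_def sum_split_first g1 by simp
  also have "\<dots> = (\<integral>x. minval x \<partial>\<mu> 1)"
    using f1_eq_minval space_mu[OF mem_1N] by (intro Bochner_Integration.integral_cong) auto
  finally have "t * (\<integral>y. h y \<partial>\<mu> j) \<le> (\<integral>x. minval x \<partial>\<mu> 1) - (\<integral>x. P x \<partial>\<mu> 1)"
    by simp
  also have "\<dots> = (\<integral>x. minval x - P x \<partial>\<mu> 1)"
    using integrable_continuous[OF mem_1N P] integrable_continuous[OF mem_1N continuous_minval] by simp
  finally show ?thesis
    unfolding P_def .
qed

lemma borel_measurable_selection_coordinate: "(\<lambda>x. selection x j) \<in> borel_measurable (\<mu> 1)"
proof -
  have "selection \<in> borel_measurable (\<mu> 1)"
    using borel_measurable_selection measurable_cong_sets[OF sets_mu[OF mem_1N] refl] by blast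
  moreover have "(\<lambda>z :: nat \<Rightarrow> real ^ 'n. z j) \<in> borel_measurable borel"
    by (intro borel_measurable_continuous_onI) simp
  ultimately show ?thesis
    by (rule measurable_compose)
qed

text \<open>
  Divide \<open>dual_first_variation\<close> by \<open>t > 0\<close> and let \<open>t\<close> tend to \<open>0\<close>.  The quotients are bounded by the bound of
  \<open>h\<close> and converge wherever the minimizer is unique, so dominated convergence applies.
\<close>
lemma integral_le_integral_selection:
  fixes h :: "real ^ 'n \<Rightarrow> real"
  assumes j: "j \<in> {2..N}" and h: "continuous_on UNIV h" and bound: "\<And>y. \<bar>h y\<bar> \<le> 1"
  shows "(\<integral>y. h y \<partial>\<mu> j) \<le> (\<integral>x. h (selection x j) \<partial>\<mu> 1)"
proof -
  interpret M: finite_measure "\<mu> 1"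
    by (rule finite_mu[OF mem_1N])
  define t where "t = (\<lambda>n. inverse (real (Suc n)))"
  have t: "t n > 0" "t \<longlonglongrightarrow> 0" for n
    unfolding t_def by (simp_all only: LIMSEQ_inverse_real_of_nat) simp
  have hD: "continuous_on (D j) h"
    using h continuous_on_subset by blast
  have hZ: "continuous_on Z (\<lambda>z. h (z j))"
    by (rule continuous_coordinate[OF j hD])
  define q where "q = (\<lambda>n x. ((INF w\<in>Z. reduced_cost x w - t n * h (w j)) - minval x) / t n)"
  have q: "continuous_on (D 1) (q n)" for n
    unfolding q_def using t(1)[of n]
    by (intro continuous_intros continuous_perturbed[OF j hD] continuous_minval) auto
  have "(\<lambda>n. \<integral>x. q n x \<partial>\<mu> 1) \<longlonglongrightarrow> (\<integral>x. - h (selection x j) \<partial>\<mu> 1)"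
  proof (rule integral_dominated_convergence[where w = "\<lambda>_. 1"])
    show "(\<lambda>x. - h (selection x j)) \<in> borel_measurable (\<mu> 1)"
      using measurable_compose[OF borel_measurable_selection_coordinate borel_measurable_continuous_onI[OF h]]
      by (intro borel_measurable_uminus)
    show "q n \<in> borel_measurable (\<mu> 1)" for n
      using integrable_continuous[OF mem_1N q] by (rule borel_measurable_integrable)
    show "AE x in \<mu> 1. (\<lambda>n. q n x) \<longlonglongrightarrow> - h (selection x j)"
      using AE_unique_minimizer AE_space
    proof eventually_elim
      case (elim x)
      then show ?case
        unfolding q_def using space_mu[OF mem_1N]
        by (intro perturbed_minval_derivative[OF hZ _ minimizers_eq_selection t]) auto
    qed
    show "AE x in \<mu> 1. norm (q n x) \<le> 1" for n
      unfolding q_def real_norm_def using bound space_mu[OF mem_1N]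
      by (intro AE_I2 perturbed_minval_quotient_bounded[OF hZ _ _ t(1)]) auto
  qed simp
  then have "(\<lambda>n. - (\<integral>x. q n x \<partial>\<mu> 1)) \<longlonglongrightarrow> - (\<integral>x. - h (selection x j) \<partial>\<mu> 1)"
    by (rule tendsto_minus)
  moreover have "(\<integral>y. h y \<partial>\<mu> j) \<le> - (\<integral>x. q n x \<partial>\<mu> 1)" for n
  proof -
    have "t n * (\<integral>y. h y \<partial>\<mu> j) \<le> (\<integral>x. - t n * q n x \<partial>\<mu> 1)"
      using dual_first_variation[OF j hD, of "t n"] t(1)[of n] by (simp add: q_def)
    also have "\<dots> = t n * - (\<integral>x. q n x \<partial>\<mu> 1)"
      by simp
    finally show ?thesis
      using t(1)[of n] by (simp only: mult_le_cancel_left_pos)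
  qed
  ultimately have "(\<integral>y. h y \<partial>\<mu> j) \<le> - (\<integral>x. - h (selection x j) \<partial>\<mu> 1)"
    by (intro LIMSEQ_le_const) auto
  then show ?thesis
    by simp
qed

lemma measurable_id_mu: "k \<in> {1..N} \<Longrightarrow> (\<lambda>x. x) \<in> borel_measurable (\<mu> k)"
  using borel_measurable_continuous_finite_borel_measure_on[OF borel_measure continuous_on_id] .

text \<open>
  The inequality \<open>integral_le_integral_selection\<close> for \<open>h\<close> and for \<open>- h\<close> is an equality of integrals.  Both
  measures are transported to \<open>borel\<close>, because \<open>\<mu> j\<close> itself lives on the subspace \<open>D j\<close>.
\<close>
lemma selection_pushforward:
  assumes j: "j \<in> {2..N}"
  shows "distr (\<mu> 1) borel (\<lambda>x. selection x j) = distr (\<mu> j) borel (\<lambda>x. x)"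
proof (rule measure_eqI_continuous_integrals)
  note j' = mem_1N_if_2N[OF j]
  note sel = borel_measurable_selection_coordinate[of j]
  show "finite_measure (distr (\<mu> 1) borel (\<lambda>x. selection x j))"
    using sel by (intro finite_measure.finite_measure_distr finite_mu mem_1N)
  show "finite_measure (distr (\<mu> j) borel (\<lambda>x. x))"
    using measurable_id_mu[OF j'] by (intro finite_measure.finite_measure_distr finite_mu j')
  fix h :: "real ^ 'n \<Rightarrow> real"
  assume h: "continuous_on UNIV h" and bound: "\<And>x. \<bar>h x\<bar> \<le> 1"
  have "(\<integral>x. h (selection x j) \<partial>\<mu> 1) \<le> (\<integral>y. h y \<partial>\<mu> j)"
    using integral_le_integral_selection[OF j, of "\<lambda>y. - h y"] h bound by (simp add: continuous_on_minus)
  with integral_le_integral_selection[OF j h bound]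
  show "(\<integral>x. h x \<partial>distr (\<mu> 1) borel (\<lambda>x. selection x j)) = (\<integral>x. h x \<partial>distr (\<mu> j) borel (\<lambda>x. x))"
    using sel measurable_id_mu[OF j'] borel_measurable_continuous_onI[OF h] by (simp add: integral_distr)
qed simp_all

lemma selection_competitor: "monge_competitor N D \<mu> (\<lambda>j x. {selection x j})"
  unfolding monge_competitor_def measure_preserving_mv_def
proof (intro ballI conjI impI)
  fix j assume j: "j \<in> {2..N}"
  note j' = mem_1N_if_2N[OF j]
  note sel = borel_measurable_selection_coordinate[of j]
  show "{selection x j} \<noteq> {}" "{selection x j} \<subseteq> D j" for x
    using coordinate_mem[OF selection_in_Z j] by auto
  show "AE x in \<mu> 1. is_singleton {selection x j}"
    by simp
  fix E assume E: "E \<in> sets borel" "E \<subseteq> space (\<mu> j)"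
  have eq: "mv_preimage (space (\<mu> 1)) (\<lambda>x. {selection x j}) E = (\<lambda>x. selection x j) -` E \<inter> space (\<mu> 1)"
    by (auto simp: mv_preimage_def)
  have meas: "(\<lambda>x. selection x j) -` E \<inter> space (\<mu> 1) \<in> sets (\<mu> 1)"
    by (rule measurable_sets[OF sel E(1)])
  then show "mv_preimage (space (\<mu> 1)) (\<lambda>x. {selection x j}) E \<in> sets (completion (\<mu> 1))"
    unfolding eq by (rule sets_completionI_sets)
  have "emeasure (\<mu> 1) ((\<lambda>x. selection x j) -` E \<inter> space (\<mu> 1)) = emeasure (distr (\<mu> j) borel (\<lambda>x. x)) E"
    unfolding selection_pushforward[OF j, symmetric] by (rule emeasure_distr[OF sel E(1), symmetric])
  also have "\<dots> = emeasure (\<mu> j) E"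
    using E by (simp add: emeasure_distr[OF measurable_id_mu[OF j'] E(1)] Int_absorb2)
  finally show "emeasure (completion (\<mu> 1)) (mv_preimage (space (\<mu> 1)) (\<lambda>x. {selection x j}) E) = emeasure (\<mu> j) E"
    unfolding eq using meas by simp
qed

section \<open>Competitors of the Monge problem and their cost\<close>

text \<open>
  The point \<open>(T\<^sub>2 x, \<dots>, T\<^sub>N x)\<close>, completed by a fixed point of \<open>Z\<close> where some \<open>T i x\<close> is
  not a singleton; in this way a competitor \<open>T\<close> gives a point of \<open>Z\<close> for every \<open>x\<close> in \<open>D 1\<close>.
\<close>
definition partner :: "(nat \<Rightarrow> real ^ 'n \<Rightarrow> (real ^ 'n) set) \<Rightarrow> real ^ 'n \<Rightarrow> nat \<Rightarrow> real ^ 'n" where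
  "partner T x = (\<lambda>i\<in>{2..N}. if is_singleton (T i x) then the_elem (T i x) else (SOME z. z \<in> Z) i)"

lemma partner_apply:
  "i \<in> {2..N} \<Longrightarrow> partner T x i = (if is_singleton (T i x) then the_elem (T i x) else (SOME z. z \<in> Z) i)"
  and partner_outside: "i \<notin> {2..N} \<Longrightarrow> partner T x i = undefined"
  by (simp_all only: partner_def restrict_apply if_True if_False)

lemma partner_in_Z:
  assumes T: "monge_competitor N D \<mu> T" and x: "x \<in> D 1"
  shows "partner T x \<in> Z"
  unfolding Z_def
proof (rule PiE_I)
  fix i assume i: "i \<in> {2..N}"
  have "(SOME z. z \<in> Z) \<in> Z"
    using Z_nonempty by (simp add: some_in_eq)
  moreover have "T i x \<subseteq> D i"
    using T i x by (auto simp: monge_competitor_def)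
  ultimately show "partner T x i \<in> D i"
    using i coordinate_mem by (auto simp: partner_apply is_singleton_the_elem)
qed (rule partner_outside)

lemma AE_graph_point_eq:
  assumes T: "monge_competitor N D \<mu> T"
  shows "AE x in \<mu> 1. graph_point N T x = (partner T x)(1 := x)"
proof -
  have "AE x in \<mu> 1. \<forall>i\<in>{2..N}. is_singleton (T i x)"
    using T by (intro AE_finite_allI) (auto simp: monge_competitor_def)
  then show ?thesis
  proof eventually_elim
    case (elim x)
    show ?case
    proof
      fix i
      consider "i = 1" | "i \<in> {2..N}" "i \<noteq> 1" | "i \<notin> {1..N}" "i \<notin> {2..N}" "i \<noteq> 1"
        using not_mem_2N unfolding atLeast1 by blast
      then show "graph_point N T x i = ((partner T x)(1 := x)) i"
      proof cases
        case 1
        then show ?thesis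
          using mem_1N by (simp add: graph_point_def)
      next
        case 2
        then show ?thesis
          using elim by (simp add: graph_point_def partner_apply)
      next
        case 3
        then show ?thesis
          by (simp only: graph_point_def partner_outside[OF 3(2)] restrict_apply fun_upd_apply if_False)
      qed
    qed
  qed
qed

text \<open>
  The preimage of a set under the map \<open>partner T\<close> and its preimage under the multivalued map \<open>T j\<close> differ
  by a null set.  It is measurable only for the completion, as the multivalued preimage is.
\<close>
lemma
  assumes T: "monge_competitor N D \<mu> T" and j: "j \<in> {2..N}"
  shows measurable_partner: "(\<lambda>x. partner T x j) \<in> completion (\<mu> 1) \<rightarrow>\<^sub>M \<mu> j"
    and distr_partner: "distr (completion (\<mu> 1)) (\<mu> j) (\<lambda>x. partner T x j) = \<mu> j"
proof -
  note j' = mem_1N_if_2N[OF j]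
  define A where "A = {x \<in> D 1. \<not> is_singleton (T j x)}"
  have "AE x in \<mu> 1. is_singleton (T j x)"
    using T j by (auto simp: monge_competitor_def)
  then have A: "AE x in \<mu> 1. x \<notin> A"
    by eventually_elim (simp add: A_def)
  have *: "(\<lambda>x. partner T x j) -` E \<inter> D 1 \<in> sets (completion (\<mu> 1)) \<and>
      emeasure (completion (\<mu> 1)) ((\<lambda>x. partner T x j) -` E \<inter> D 1) = emeasure (\<mu> j) E"
    if "E \<in> sets (\<mu> j)" for E
  proof -
    have E: "E \<in> sets borel" "E \<subseteq> D j"
      using that sets_mu_iff[OF j'] by auto
    define Q where "Q = mv_preimage (D 1) (T j) E"
    have Q: "Q \<in> sets (completion (\<mu> 1))" "emeasure (completion (\<mu> 1)) Q = emeasure (\<mu> j) E"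
      using T j E space_mu[OF mem_1N] space_mu[OF j']
      unfolding monge_competitor_def measure_preserving_mv_def Q_def by metis+
    define R where "R = (\<lambda>x. partner T x j) -` E \<inter> D 1"
    have iff: "x \<in> R \<longleftrightarrow> x \<in> Q" if "x \<notin> A" for x
    proof (cases "x \<in> D 1")
      case True
      then obtain y where "T j x = {y}"
        using \<open>x \<notin> A\<close> by (auto simp: A_def is_singleton_def)
      then show ?thesis
        using j True by (simp add: R_def Q_def mv_preimage_def partner_apply)
    qed (simp add: R_def Q_def mv_preimage_def)
    have AE: "AE x in \<mu> 1. x \<in> Q \<longleftrightarrow> x \<in> R"
      using A by eventually_elim (simp add: iff)
    have R: "R \<in> sets (completion (\<mu> 1))"
      using space_mu[OF mem_1N] by (intro sets_completion_cong_AE[OF Q(1) _ AE]) (auto simp: R_def)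
    have "AE x in completion (\<mu> 1). x \<in> R \<longleftrightarrow> x \<in> Q"
      using AE_completion[OF AE] by eventually_elim simp
    then have "emeasure (completion (\<mu> 1)) R = emeasure (completion (\<mu> 1)) Q"
      using R Q(1) by (rule emeasure_eq_AE)
    then show ?thesis
      using R Q(2) by (simp add: R_def)
  qed
  note space = space_mu[OF mem_1N]
  show meas: "(\<lambda>x. partner T x j) \<in> completion (\<mu> 1) \<rightarrow>\<^sub>M \<mu> j"
  proof (rule measurableI)
    show "partner T x j \<in> space (\<mu> j)" if "x \<in> space (completion (\<mu> 1))" for x
      using that coordinate_mem[OF partner_in_Z[OF T] j] by (simp add: space space_mu[OF j'])
  qed (use * in \<open>simp add: space\<close>)
  show "distr (completion (\<mu> 1)) (\<mu> j) (\<lambda>x. partner T x j) = \<mu> j"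
  proof (rule measure_eqI)
    fix E assume "E \<in> sets (distr (completion (\<mu> 1)) (\<mu> j) (\<lambda>x. partner T x j))"
    then have E: "E \<in> sets (\<mu> j)"
      by simp
    show "emeasure (distr (completion (\<mu> 1)) (\<mu> j) (\<lambda>x. partner T x j)) E = emeasure (\<mu> j) E"
      using *[OF E] emeasure_distr[OF meas E] unfolding space_completion space by argo
  qed simp
qed

text \<open>
  Since \<open>T j\<close> pushes \<open>\<mu> 1\<close> to \<open>\<mu> j\<close>, the integral of \<open>f j (T\<^sub>j x)\<close> against \<open>\<mu> 1\<close> is that of \<open>f j\<close> against
  \<open>\<mu> j\<close>; and \<open>minval\<close> is \<open>f 1\<close> on \<open>D 1\<close>.  So these integrals add up to the dual functional.
\<close>
lemma
  assumes T: "monge_competitor N D \<mu> T"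
  shows integrable_excess: "integrable (completion (\<mu> 1)) (\<lambda>x. reduced_cost x (partner T x) - minval x)"
    and integral_excess: "(\<integral>x. reduced_cost x (partner T x) - minval x \<partial>completion (\<mu> 1)) =
      monge_cost N \<mu> c T - dual_functional N \<mu> f"
proof -
  interpret M: finite_measure "\<mu> 1"
    by (rule finite_mu[OF mem_1N])
  interpret M': finite_measure "completion (\<mu> 1)"
    using M.finite_emeasure_space by (intro finite_measureI) (simp add: emeasure_completion)
  define p where "p = (\<lambda>x. (partner T x)(1 := x))"
  note space = space_mu[OF mem_1N]
  have p_mem: "p x \<in> Pi\<^sub>E {1..N} D" if "x \<in> D 1" for x
    unfolding p_def by (rule update_mem[OF that partner_in_Z[OF T that]])
  have "p \<in> borel_measurable (completion (\<mu> 1))"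
  proof (rule measurable_coordinatewise_then_product)
    fix i
    show "(\<lambda>x. p x i) \<in> borel_measurable (completion (\<mu> 1))"
    proof (cases "i = 1")
      case True
      then show ?thesis
        using measurable_completion[OF measurable_id_mu[OF mem_1N]] by (simp add: p_def)
    next
      case False
      show ?thesis
      proof (cases "i \<in> {2..N}")
        case True
        from measurable_compose[OF measurable_partner[OF T True] measurable_id_mu[OF mem_1N_if_2N[OF True]]]
        show ?thesis
          using False by (simp add: p_def)
      next
        case out: False
        show ?thesis
          unfolding p_def fun_upd_other[OF False] partner_outside[OF out] by simp
      qed
    qed
  qed
  moreover have cl: "compact (Pi\<^sub>E {1..N} D)"
    using compact_D by (rule compact_PiE)
  have cc: "continuous_on (Pi\<^sub>E {1..N} D) c"
    using C1 by (simp add: C1_cost_def)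
  have "(\<lambda>q. indicator (Pi\<^sub>E {1..N} D) q *\<^sub>R c q) \<in> borel_measurable borel"
    using cc cl by (intro borel_measurable_continuous_on_indicator borel_closed compact_imp_closed)
  ultimately have "(\<lambda>x. indicator (Pi\<^sub>E {1..N} D) (p x) *\<^sub>R c (p x)) \<in> borel_measurable (completion (\<mu> 1))"
    by (rule measurable_compose)
  then have c_meas: "(\<lambda>x. c (p x)) \<in> borel_measurable (completion (\<mu> 1))"
    by (rule measurable_cong[THEN iffD1, rotated]) (simp add: space p_mem)
  obtain K where K: "\<And>q. q \<in> Pi\<^sub>E {1..N} D \<Longrightarrow> norm (c q) \<le> K"
    using compact_imp_bounded[OF compact_continuous_image[OF cc cl]] by (auto simp: bounded_iff)
  have c_int: "integrable (completion (\<mu> 1)) (\<lambda>x. c (p x))"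
    using c_meas K p_mem by (intro M'.integrable_const_bound[where B = K] AE_I2) (simp_all add: space)
  have f_int: "integrable (completion (\<mu> 1)) (\<lambda>x. f k (partner T x k))"
    and f_eq: "(\<integral>x. f k (partner T x k) \<partial>completion (\<mu> 1)) = (\<integral>y. f k y \<partial>\<mu> k)" if "k \<in> {2..N}" for k
  proof -
    note k' = mem_1N_if_2N[OF that]
    have int: "integrable (\<mu> k) (f k)"
      by (rule integrable_continuous[OF k' continuous_f[OF k']])
    then have m: "f k \<in> borel_measurable (\<mu> k)"
      by (rule borel_measurable_integrable)
    show "integrable (completion (\<mu> 1)) (\<lambda>x. f k (partner T x k))"
      using integrable_distr_eq[OF measurable_partner[OF T that] m] int by (simp add: distr_partner[OF T that])
    show "(\<integral>x. f k (partner T x k) \<partial>completion (\<mu> 1)) = (\<integral>y. f k y \<partial>\<mu> k)"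
      using integral_distr[OF measurable_partner[OF T that] m] by (simp add: distr_partner[OF T that])
  qed
  have min_int: "integrable (\<mu> 1) minval"
    by (rule integrable_continuous[OF mem_1N continuous_minval])
  then have min_meas: "minval \<in> borel_measurable (\<mu> 1)"
    by (rule borel_measurable_integrable)
  have min_int': "integrable (completion (\<mu> 1)) minval"
    using min_int integrable_completion[OF min_meas] by simp
  have reduced_cost_eq: "reduced_cost x (partner T x) = c (p x) - (\<Sum>k=2..N. f k (partner T x k))" for x
    by (simp add: reduced_cost_def p_def)
  have sum_int: "integrable (completion (\<mu> 1)) (\<lambda>x. \<Sum>k=2..N. f k (partner T x k))"
    using f_int by (rule Bochner_Integration.integrable_sum)
  have sum_eq: "(\<integral>x. (\<Sum>k=2..N. f k (partner T x k)) \<partial>completion (\<mu> 1)) =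
      (\<Sum>k=2..N. \<integral>x. f k (partner T x k) \<partial>completion (\<mu> 1))"
    by (rule Bochner_Integration.integral_sum) (rule f_int)
  show "integrable (completion (\<mu> 1)) (\<lambda>x. reduced_cost x (partner T x) - minval x)"
    unfolding reduced_cost_eq using c_int sum_int min_int' by (intro Bochner_Integration.integrable_diff)
  have "(\<integral>x. reduced_cost x (partner T x) - minval x \<partial>completion (\<mu> 1)) =
      (\<integral>x. c (p x) \<partial>completion (\<mu> 1)) - (\<Sum>k=2..N. \<integral>x. f k (partner T x k) \<partial>completion (\<mu> 1))
        - (\<integral>x. minval x \<partial>completion (\<mu> 1))"
    unfolding reduced_cost_eq using c_int sum_int min_int' by (simp add: sum_eq)
  also have "(\<Sum>k=2..N. \<integral>x. f k (partner T x k) \<partial>completion (\<mu> 1)) = (\<Sum>k=2..N. \<integral>y. f k y \<partial>\<mu> k)"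
    by (intro sum.cong refl f_eq)
  also have "(\<integral>x. minval x \<partial>completion (\<mu> 1)) = (\<integral>x. f 1 x \<partial>\<mu> 1)"
    unfolding integral_completion[OF min_meas]
    using f1_eq_minval space_mu[OF mem_1N] by (intro Bochner_Integration.integral_cong) auto
  also have "(\<integral>x. c (p x) \<partial>completion (\<mu> 1)) = monge_cost N \<mu> c T"
  proof -
    have AE: "AE x in \<mu> 1. c (p x) = c (graph_point N T x)"
      using AE_graph_point_eq[OF T] by eventually_elim (simp add: p_def)
    have "(\<lambda>x. c (graph_point N T x)) \<in> borel_measurable (completion (\<mu> 1))"
      using AE by (intro measurable_completion_cong_AE[OF c_meas]) auto
    with c_meas show ?thesis
      unfolding monge_cost_def using AE_completion[OF AE] by (rule integral_cong_AE)
  qed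
  finally show "(\<integral>x. reduced_cost x (partner T x) - minval x \<partial>completion (\<mu> 1)) =
      monge_cost N \<mu> c T - dual_functional N \<mu> f"
    unfolding dual_functional_def sum_split_first by simp
qed

text \<open>
  The selection of minimizers is a competitor with excess integral \<open>0\<close>, so an optimal map has excess integral at most
  \<open>0\<close>.  Its excess is nonnegative, hence vanishes almost everywhere, and the optimal map takes minimizers as
  values.  Where the minimizer is unique the envelope theorem applies.
\<close>
theorem optimal_gradient:
  assumes T: "optimal_monge_map N D \<mu> c T"
  shows "AE x in \<mu> 1. GDERIV (f 1) x :> grad_c 1 (graph_point N T x)"
proof -
  define S where "S = (\<lambda>j x. {selection x j})"
  have S: "monge_competitor N D \<mu> S"
    unfolding S_def by (rule selection_competitor)
  have partner_S: "partner S x = selection x" for x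
    using PiE_restrict[of "selection x" "{2..N}" D] selection_in_Z[of x]
    by (simp add: partner_def S_def Z_def)
  have "AE x in completion (\<mu> 1). reduced_cost x (partner S x) - minval x = 0"
    using AE_completion[OF AE_unique_minimizer]
  proof eventually_elim
    case (elim x)
    then show ?case
      using minimizers_eq_selection unfolding partner_S by (force simp: minimizers_def)
  qed
  then have "(\<integral>x. reduced_cost x (partner S x) - minval x \<partial>completion (\<mu> 1)) = 0"
    by (rule integral_eq_zero_AE)
  then have "monge_cost N \<mu> c S = dual_functional N \<mu> f"
    using integral_excess[OF S] by simp
  moreover have comp: "monge_competitor N D \<mu> T" and "monge_cost N \<mu> c T \<le> monge_cost N \<mu> c S"
    using T S by (auto simp: optimal_monge_map_def)
  ultimately have le: "(\<integral>x. reduced_cost x (partner T x) - minval x \<partial>completion (\<mu> 1)) \<le> 0"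
    using integral_excess[OF comp] by simp
  have nonneg: "AE x in completion (\<mu> 1). 0 \<le> reduced_cost x (partner T x) - minval x"
    using partner_in_Z[OF comp] minval_le space_mu[OF mem_1N] by (intro AE_I2) simp
  have "(\<integral>x. reduced_cost x (partner T x) - minval x \<partial>completion (\<mu> 1)) = 0"
    using le integral_nonneg_AE[OF nonneg] by simp
  then have "AE x in completion (\<mu> 1). reduced_cost x (partner T x) - minval x = 0"
    using integral_nonneg_eq_0_iff_AE[OF integrable_excess[OF comp] nonneg] by simp
  then have "AE x in \<mu> 1. reduced_cost x (partner T x) - minval x = 0"
    by (simp add: AE_completion_iff)
  then show ?thesis
    using AE_unique_minimizer AE_interior AE_graph_point_eq[OF comp]
  proof eventually_elim
    case (elim x)
    have x: "x \<in> D 1"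
      using elim(3) interior_subset by blast
    have "partner T x \<in> minimizers x"
      using elim(1) partner_in_Z[OF comp x] by (simp add: minimizers_def)
    then have "minimizers x = {partner T x}"
      using minimizers_eq_selection[OF elim(2)] by auto
    from gderiv_at_unique_minimizer[OF elim(3) this f1_eq_minval]
    show ?case
      unfolding elim(4) .
  qed
qed

end

section \<open>Gradients of optimal potentials along optimal maps\<close>

theorem theorem4p3:
  fixes N :: nat
    and D :: "nat \<Rightarrow> (real ^ 'n) set"
    and \<mu> :: "nat \<Rightarrow> (real ^ 'n) measure"
    and c :: "(nat \<Rightarrow> real ^ 'n) \<Rightarrow> real"
    and grad_c :: "nat \<Rightarrow> (nat \<Rightarrow> real ^ 'n) \<Rightarrow> real ^ 'n"
    and f :: "nat \<Rightarrow> real ^ 'n \<Rightarrow> real"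
    and T :: "nat \<Rightarrow> real ^ 'n \<Rightarrow> (real ^ 'n) set"
  assumes "N \<ge> 2"
    and "\<forall>i\<in>{1..N}. compact_domain (D i)"
    and "\<forall>i\<in>{1..N}. finite_borel_measure_on (D i) (\<mu> i)"
    and "\<forall>i\<in>{1..N}. emeasure (\<mu> i) (D i) = emeasure (\<mu> 1) (D 1)"
    and "emeasure (\<mu> 1) (frontier (D 1)) = 0"
    and "\<forall>G. open G \<and> G \<noteq> {} \<and> G \<subseteq> D 1 \<longrightarrow> emeasure (\<mu> 1) G > 0"
    and "lipschitz_cost N D c"
    and "C1_cost N D c grad_c"
    and "\<forall>x\<in>D 1. inj_on (\<lambda>z. grad_c 1 (z(1 := x))) (Pi\<^sub>E {2..N} D)"
    and "f \<in> admissible_class N D c"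
    and "c_conjugate N D c f"
    and "dual_maximizer N D \<mu> c f"
    and "absolutely_continuous (restrict_space lborel (D 1)) (\<mu> 1) \<or>
         (AE x in \<mu> 1. f 1 differentiable (at x))"
    and "optimal_monge_map N D \<mu> c T"
  shows "AE x in \<mu> 1. GDERIV (f 1) x :> grad_c 1 (graph_point N T x)"
proof -
  interpret conjugate_potentials N D \<mu> c grad_c f
  proof
    show "compact_domain (D i)" if "i \<in> {1..N}" for i
      using assms(2) that by blast
    show "finite_borel_measure_on (D i) (\<mu> i)" if "i \<in> {1..N}" for i
      using assms(3) that by blast
    show "inj_on (\<lambda>z. grad_c 1 (z(1 := x))) (Pi\<^sub>E {2..N} D)" if "x \<in> D 1" for x
      using assms(9) that by blast
  qed (fact assms)+
  show ?thesis
    by (rule optimal_gradient) (fact assms)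
qed

end
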